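(* Let $G$ be a real Lie group with a $C^\infty$ action on a $C^\infty$ real manifold $M$. For all $x\in M$, let $G'_x := \{g\in G \mid \forall v\in T_xM,\ gv=v\}$. Assume that the $G$-action on $M$ is locally free and fixpoint rare. Let $L:=\{x\in M \mid G'_x\neq\{1_G\}\}$. Then $L$ is meager in $M$.
   Context: Manifolds are finite-dimensional $C^\infty$ real manifolds and Lie groups are finite-dimensional real Lie groups (not necessarily connected); both are Hausdorff and second countable. An action of $G$ on $M$ is $C^\infty$ if the action map $G\times M\to M$ is $C^\infty$. Let $1_G$ be the identity element of $G$. A $C^\infty$ action of $G$ on $M$ induces by differentiation an action of $G$ on the tangent bundle $TM$: for $g\in G$ and $v\in T_xM$, $gv\in T_{gx}M$ is the image of $v$ under the differential of $y\mapsto gy$. Thus $gv=v$ for some $v\in T_xM$ forces $gx=x$. For $x\in M$, $\mathrm{Stab}_G(x):=\{g\in G\mid gx=x\}$. The action is locally free if, for all $x\in M$, $\mathrm{Stab}_G(x)$ is discrete. The action is fixpoint rare if, for all $g\in G\setminus\{1_G\}$, the set $\{x\in M\mid gx=x\}$ has empty interior in $M$. A subset of a topological space is meager if it is a countable union of nowhere dense subsets. *)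

theory Defs
  imports "HOL-Analysis.Analysis" "HOL-Algebra.Group_Action"
begin

section \<open>Smooth maps between open subsets of finite-dimensional vector spaces\<close>

text \<open>
  The model spaces are linear subspaces \<open>E\<close> of a type of class \<open>euclidean_space\<close>, rather than the
  whole type, because such a type has dimension at least 1, whereas discrete Lie groups and
  0-dimensional manifolds have to be included.

  \<open>Ck_on k E S f\<close> is meant for \<open>S\<close> relatively open in \<open>E\<close>. Then the values \<open>f' x v\<close> for \<open>v \<in> E\<close>
  are determined by \<open>f\<close>; those for other \<open>v\<close> are not and play no role.
\<close>

primrec Ck_on ::
    "nat \<Rightarrow> 'a::euclidean_space set \<Rightarrow> 'a set \<Rightarrow> ('a \<Rightarrow> 'b::real_normed_vector) \<Rightarrow> bool" where
  "Ck_on 0 E S f \<longleftrightarrow> continuous_on S f"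
| "Ck_on (Suc k) E S f \<longleftrightarrow>
     (\<exists>f'. (\<forall>x\<in>S. (f has_derivative f' x) (at x within S)) \<and>
           (\<forall>v\<in>E. Ck_on k E S (\<lambda>x. f' x v)))"

definition smooth_on ::
    "'a::euclidean_space set \<Rightarrow> 'a set \<Rightarrow> ('a \<Rightarrow> 'b::real_normed_vector) \<Rightarrow> bool" where
  "smooth_on E S f \<longleftrightarrow> (\<forall>k. Ck_on k E S f)"


section \<open>Manifolds and smooth maps\<close>

record ('m, 'e) chart =
  chart_model :: "'e set"
  chart_dom :: "'m set"
  chart_map :: "'m \<Rightarrow> 'e"

definition chart_inv :: "('m, 'e) chart \<Rightarrow> 'e \<Rightarrow> 'm" where
  "chart_inv a = inv_into (chart_dom a) (chart_map a)"

definition is_chart :: "'m topology \<Rightarrow> ('m, 'e::euclidean_space) chart \<Rightarrow> bool" where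
  "is_chart X a \<longleftrightarrow>
     subspace (chart_model a) \<and>
     openin X (chart_dom a) \<and>
     openin (top_of_set (chart_model a)) (chart_map a ` chart_dom a) \<and>
     homeomorphic_map (subtopology X (chart_dom a)) (top_of_set (chart_map a ` chart_dom a))
       (chart_map a)"

definition smooth_compatible ::
    "('m, 'e::euclidean_space) chart \<Rightarrow> ('m, 'e) chart \<Rightarrow> bool" where
  "smooth_compatible a b \<longleftrightarrow>
     smooth_on (chart_model a) (chart_map a ` (chart_dom a \<inter> chart_dom b))
       (chart_map b \<circ> chart_inv a)"

text \<open>
  The smooth structure is the one generated by the atlas \<open>A\<close>, which need not be maximal. The model
  space is part of the chart, so that distinct connected components may have distinct dimensions;
  a manifold of pure dimension \<open>n\<close> is the case where all model spaces have dimension \<open>n\<close>.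
\<close>

locale smooth_manifold =
  fixes X :: "'m topology" and A :: "('m, 'e::euclidean_space) chart set"
  assumes Hausdorff: "Hausdorff_space X"
    and second_countable: "second_countable X"
    and charts: "a \<in> A \<Longrightarrow> is_chart X a"
    and covering: "\<Union> (chart_dom ` A) = topspace X"
    and compatible: "\<lbrakk>a \<in> A; b \<in> A\<rbrakk> \<Longrightarrow> smooth_compatible a b"

definition smooth_map ::
    "'m topology \<Rightarrow> ('m, 'e::euclidean_space) chart set \<Rightarrow>
     'n topology \<Rightarrow> ('n, 'f::euclidean_space) chart set \<Rightarrow> ('m \<Rightarrow> 'n) \<Rightarrow> bool" where
  "smooth_map X A Y B f \<longleftrightarrow>
     continuous_map X Y f \<and>
     (\<forall>a\<in>A. \<forall>b\<in>B.
        smooth_on (chart_model a) (chart_map a ` {x \<in> chart_dom a. f x \<in> chart_dom b})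
          (chart_map b \<circ> f \<circ> chart_inv a))"

definition prod_chart :: "('m, 'e) chart \<Rightarrow> ('n, 'f) chart \<Rightarrow> ('m \<times> 'n, 'e \<times> 'f) chart" where
  "prod_chart a b =
     \<lparr>chart_model = chart_model a \<times> chart_model b,
      chart_dom = chart_dom a \<times> chart_dom b,
      chart_map = (\<lambda>(x, y). (chart_map a x, chart_map b y))\<rparr>"

definition prod_atlas ::
    "('m, 'e) chart set \<Rightarrow> ('n, 'f) chart set \<Rightarrow> ('m \<times> 'n, 'e \<times> 'f) chart set" where
  "prod_atlas A B = (\<lambda>(a, b). prod_chart a b) ` (A \<times> B)"

definition interval_atlas :: "real \<Rightarrow> (real, real) chart set" where
  "interval_atlas r =
     {\<lparr>chart_model = UNIV, chart_dom = {-r<..<r}, chart_map = (\<lambda>t. t)\<rparr>}"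


section \<open>Tangent spaces and differentials\<close>

text \<open>
  Tangent vectors at \<open>x\<close> are classes of smooth curves through \<open>x\<close> with the same velocity in charts.
  Curves are total functions on the reals, but only their germs at 0 matter.
  The tangent spaces at distinct points are disjoint, since \<open>c 0 = x\<close> for every curve \<open>c\<close> in
  a class at \<open>x\<close>. So the tangent bundle is the plain union of the tangent spaces,
  and an equation between tangent vectors includes the equality of their base points.
\<close>

definition curves_at ::
    "'m topology \<Rightarrow> ('m, 'e::euclidean_space) chart set \<Rightarrow> 'm \<Rightarrow> (real \<Rightarrow> 'm) set" where
  "curves_at X A x =
     {c. c 0 = x \<and> (\<exists>r>0. smooth_map (top_of_set {-r<..<r}) (interval_atlas r) X A c)}"

definition tangent_rel ::
    "'m topology \<Rightarrow> ('m, 'e::euclidean_space) chart set \<Rightarrow> 'm \<Rightarrow> (real \<Rightarrow> 'm) rel" where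
  "tangent_rel X A x =
     {(c, d). c \<in> curves_at X A x \<and> d \<in> curves_at X A x \<and>
        (\<forall>a\<in>A. x \<in> chart_dom a \<longrightarrow>
           vector_derivative (chart_map a \<circ> c) (at 0) =
           vector_derivative (chart_map a \<circ> d) (at 0))}"

definition tangent_space ::
    "'m topology \<Rightarrow> ('m, 'e::euclidean_space) chart set \<Rightarrow> 'm \<Rightarrow> (real \<Rightarrow> 'm) set set" where
  "tangent_space X A x = curves_at X A x // tangent_rel X A x"

definition differential ::
    "'n topology \<Rightarrow> ('n, 'f::euclidean_space) chart set \<Rightarrow> ('m \<Rightarrow> 'n) \<Rightarrow> 'm \<Rightarrow>
     (real \<Rightarrow> 'm) set \<Rightarrow> (real \<Rightarrow> 'n) set" where
  "differential Y B f x v = (\<Union>c\<in>v. tangent_rel Y B (f x) `` {f \<circ> c})"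


section \<open>Lie groups and smooth actions\<close>

locale lie_group = group G + smooth_manifold T A
  for G :: "('g, 'z) monoid_scheme" (structure)
    and T :: "'g topology" and A :: "('g, 'd::euclidean_space) chart set" +
  assumes topspace_eq: "topspace T = carrier G"
    and smooth_mult:
      "smooth_map (prod_topology T T) (prod_atlas A A) T A (\<lambda>(g, h). mult G g h)"
    and smooth_inv: "smooth_map T A T A (m_inv G)"

locale smooth_action =
  lie_group G T A + smooth_manifold X B + group_action G "topspace X" \<phi>
  for G :: "('g, 'z) monoid_scheme" (structure)
    and T :: "'g topology" and A :: "('g, 'd::euclidean_space) chart set"
    and X :: "'m topology" and B :: "('m, 'e::euclidean_space) chart set"
    and \<phi> :: "'g \<Rightarrow> 'm \<Rightarrow> 'm" +
  assumes smooth_act: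
    "smooth_map (prod_topology T X) (prod_atlas A B) X B (\<lambda>(g, x). \<phi> g x)"

definition locally_free ::
    "('g, 'z) monoid_scheme \<Rightarrow> 'g topology \<Rightarrow> 'm topology \<Rightarrow> ('g \<Rightarrow> 'm \<Rightarrow> 'm) \<Rightarrow> bool" where
  "locally_free G T X \<phi> \<longleftrightarrow>
     (\<forall>x\<in>topspace X. subtopology T (stabilizer G \<phi> x) = discrete_topology (stabilizer G \<phi> x))"

definition fixpoint_rare ::
    "('g, 'z) monoid_scheme \<Rightarrow> 'm topology \<Rightarrow> ('g \<Rightarrow> 'm \<Rightarrow> 'm) \<Rightarrow> bool" where
  "fixpoint_rare G X \<phi> \<longleftrightarrow>
     (\<forall>g\<in>carrier G - {one G}. X interior_of (invariants (topspace X) \<phi> g) = {})"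

definition tangent_stabilizer ::
    "('g, 'z) monoid_scheme \<Rightarrow> 'm topology \<Rightarrow> ('m, 'e::euclidean_space) chart set \<Rightarrow>
     ('g \<Rightarrow> 'm \<Rightarrow> 'm) \<Rightarrow> 'm \<Rightarrow> 'g set" where
  "tangent_stabilizer G X B \<phi> x =
     {g \<in> carrier G. \<forall>v\<in>tangent_space X B x. differential X B (\<phi> g) x v = v}"


section \<open>Meager sets\<close>

definition nowhere_dense_in :: "'m topology \<Rightarrow> 'm set \<Rightarrow> bool" where
  "nowhere_dense_in X S \<longleftrightarrow> S \<subseteq> topspace X \<and> X interior_of (X closure_of S) = {}"

definition meager_in :: "'m topology \<Rightarrow> 'm set \<Rightarrow> bool" where
  "meager_in X S \<longleftrightarrow> (\<exists>\<N>. countable \<N> \<and> (\<forall>N\<in>\<N>. nowhere_dense_in X N) \<and> S = \<Union>\<N>)"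

end

theory Submission
  imports Defs
begin

text \<open>
  Suppose that \<open>g0 \<noteq> \<one>\<close> fixes \<open>x0\<close> and all tangent vectors at \<open>x0\<close>. Local freeness makes the orbit
  map of \<open>x0\<close> an immersion, so near \<open>(g0, x0)\<close> an equation \<open>\<phi> g x = x\<close> determines \<open>g\<close> as a Lipschitz
  function of \<open>x\<close>, and this function has derivative zero wherever \<open>g\<close> also fixes the tangent space at
  \<open>x\<close>. If such \<open>x\<close> filled an open set, then \<open>g \<noteq> \<one>\<close> would be constant on a smaller open set and fix all
  of its points, against fixpoint rarity. Since the pairs \<open>(g, x)\<close> with \<open>g\<close> trivial on the tangent space
  at \<open>x\<close> form a closed set, letting \<open>g\<close> range over a compact neighbourhood of \<open>g0\<close> yields locally closed
  sets with empty interior, and countably many of these cover the exceptional set.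
\<close>

section \<open>Charts\<close>

text \<open>In charts, let D be the derivative of the action at (g0, x0). As g0 acts trivially on
  the tangent space, D (u, v) = D (u, 0) + v, so in the difference of the equations \<phi> g x = x
  and \<phi> h y = y the term v cancels, and injectivity of u \<mapsto> D (u, 0) gives |g - h| \<le>
  e |x - y| near (g0, x0), for any e > 0 after shrinking the neighbourhood. The case e = 1 is the
  Lipschitz dependence; arbitrary e, applied at further points of the same kind, is the vanishing
  derivative. The implicit function theorem does not fit: u \<mapsto> D (u, 0) is only injective, so
  a given x need not be fixed by any g near g0; what survives is uniqueness. Two solutions move
  independently, which is why derivatives are strict: they control differences of two arbitrary
  points near the base point. The same uniformity lets the condition on tangent spaces pass to
  limits. The identity obstructs a global argument: every pair (\<one>, x) lies in the closed set,
  so g is confined to a compact set avoiding \<one>. Compactness also makes the projection to the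
  manifold a closed map.\<close>

lemma is_chartD:
  assumes "is_chart X a"
  shows "subspace (chart_model a)" "openin X (chart_dom a)"
    "openin (top_of_set (chart_model a)) (chart_map a ` chart_dom a)"
    "homeomorphic_map (subtopology X (chart_dom a)) (top_of_set (chart_map a ` chart_dom a))
       (chart_map a)"
    "chart_dom a \<subseteq> topspace X" "chart_map a ` chart_dom a \<subseteq> chart_model a"
  using assms openin_imp_subset[of euclidean "chart_model a" "chart_map a ` chart_dom a"] openin_subset[of X]
  unfolding is_chart_def by simp_all

lemma chart_inj:
  assumes "is_chart X a" shows "inj_on (chart_map a) (chart_dom a)"
  using homeomorphic_imp_injective_map[OF is_chartD(4)[OF assms]] is_chartD(5)[OF assms]
  by (simp add: topspace_subtopology Int_absorb1)

lemma chart_inv_left: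
  "is_chart X a \<Longrightarrow> x \<in> chart_dom a \<Longrightarrow> chart_inv a (chart_map a x) = x"
  by (simp add: chart_inv_def chart_inj)

lemma chart_inv_dom:
  "e \<in> chart_map a ` chart_dom a \<Longrightarrow> chart_inv a e \<in> chart_dom a"
  by (simp add: chart_inv_def inv_into_into)

lemma chart_inv_right:
  "e \<in> chart_map a ` chart_dom a \<Longrightarrow> chart_map a (chart_inv a e) = e"
  by (simp add: chart_inv_def f_inv_into_f)

lemma chart_map_model:
  "is_chart X a \<Longrightarrow> x \<in> chart_dom a \<Longrightarrow> chart_map a x \<in> chart_model a"
  using is_chartD(6) by blast

lemma chart_diff_model:
  "is_chart X a \<Longrightarrow> x \<in> chart_dom a \<Longrightarrow> y \<in> chart_dom a
    \<Longrightarrow> chart_map a x - chart_map a y \<in> chart_model a"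
  by (simp add: chart_map_model is_chartD(1) subspace_diff)

lemma chart_continuous:
  assumes "is_chart X a"
  shows "continuous_map (subtopology X (chart_dom a)) euclidean (chart_map a)"
  using homeomorphic_imp_continuous_map[OF is_chartD(4)[OF assms]]
  by (simp add: continuous_map_in_subtopology)

lemma chart_open_vimage:
  assumes "is_chart X a" "open S"
  shows "openin X {x \<in> chart_dom a. chart_map a x \<in> S}"
proof -
  have "openin (subtopology X (chart_dom a)) {x \<in> topspace (subtopology X (chart_dom a)). chart_map a x \<in> S}"
    using chart_continuous[OF assms(1)] assms(2) by (intro openin_continuous_map_preimage) auto
  then show ?thesis
    using is_chartD(2,5)[OF assms(1)]
    by (simp add: topspace_subtopology Int_absorb1 openin_open_subtopology)
qed

lemma chart_open_image:
  assumes "is_chart X a" "openin X U" "U \<subseteq> chart_dom a"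
  shows "openin (top_of_set (chart_model a)) (chart_map a ` U)"
proof -
  have "openin (subtopology X (chart_dom a)) U"
    using assms is_chartD(2)[OF assms(1)] by (simp add: openin_open_subtopology)
  then have "openin (top_of_set (chart_map a ` chart_dom a)) (chart_map a ` U)"
    using homeomorphic_imp_open_map[OF is_chartD(4)[OF assms(1)]] by (simp add: open_map_def)
  then show ?thesis
    using is_chartD(3)[OF assms(1)] openin_trans by blast
qed

text \<open>Phrased with points of the manifold instead of the chart inverse. Together with
  injectivity of the chart it turns closeness in coordinates into membership in \<open>U\<close>;
  the ball is closed so that its intersection with the model is compact.\<close>

lemma chart_nbhd:
  assumes "is_chart X a" "openin X U" "p \<in> U" "p \<in> chart_dom a"
  obtains r where "r > 0"
    "\<And>e. e \<in> chart_model a \<Longrightarrow> norm (e - chart_map a p) \<le> r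
       \<Longrightarrow> \<exists>x \<in> U \<inter> chart_dom a. chart_map a x = e"
proof -
  have "openin (top_of_set (chart_model a)) (chart_map a ` (U \<inter> chart_dom a))"
    using assms is_chartD(2)[OF assms(1)] by (intro chart_open_image) auto
  then obtain r where "r > 0"
    and r: "cball (chart_map a p) r \<inter> chart_model a \<subseteq> chart_map a ` (U \<inter> chart_dom a)"
    using assms(3,4) unfolding openin_contains_cball by blast
  show ?thesis
  proof (rule that[OF \<open>r > 0\<close>])
    fix e assume "e \<in> chart_model a" "norm (e - chart_map a p) \<le> r"
    then have "e \<in> chart_map a ` (U \<inter> chart_dom a)"
      using r by (intro subsetD[OF r]) (auto simp: dist_norm norm_minus_commute)
    then show "\<exists>x \<in> U \<inter> chart_dom a. chart_map a x = e" by (metis imageE)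
  qed
qed

text \<open>Supplies the test points that pin down a derivative on the model space: linearity
  removes the factor \<open>t\<close>, so one short step in the direction \<open>u\<close> is
  enough.\<close>

lemma chart_ray:
  assumes a: "is_chart X a" and "openin X U" "p \<in> U" and p: "p \<in> chart_dom a" and u: "u \<in> chart_model a"
  obtains t x where "t > 0" "x \<in> U" "chart_map a x = chart_map a p + t *\<^sub>R u"
proof -
  obtain r where r: "r > 0"
    "\<And>w. w \<in> chart_model a \<Longrightarrow> norm (w - chart_map a p) \<le> r
       \<Longrightarrow> \<exists>x \<in> U \<inter> chart_dom a. chart_map a x = w"
    using chart_nbhd[OF assms(1-3) p] by blast
  \<comment> \<open>The summand 1 covers the direction \<open>u = 0\<close>.\<close>
  define t where "t = r / (norm u + 1)"
  have n1: "0 < norm u + 1" using norm_ge_zero[of u] by linarith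
  then have t: "t > 0" using r(1) by (simp add: t_def)
  have "t * norm u \<le> t * (norm u + 1)" using t by simp
  also have "\<dots> = r" using n1 by (simp add: t_def)
  finally have tr: "t * norm u \<le> r" .
  have "chart_map a p + t *\<^sub>R u \<in> chart_model a"
    using is_chartD(1)[OF a] chart_map_model[OF a p] u by (simp add: subspace_add subspace_scale)
  moreover have "norm (chart_map a p + t *\<^sub>R u - chart_map a p) \<le> r"
    using t tr by simp
  ultimately obtain x where "x \<in> U" "chart_map a x = chart_map a p + t *\<^sub>R u"
    using r(2) by blast
  then show ?thesis using that t by blast
qed

lemma chart_inv_continuous:
  assumes "is_chart X a"
  shows "continuous_map (top_of_set (chart_map a ` chart_dom a)) X (chart_inv a)"
proof -
  let ?Y = "top_of_set (chart_map a ` chart_dom a)"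
  obtain g where g: "homeomorphic_maps (subtopology X (chart_dom a)) ?Y (chart_map a) g"
    using is_chartD(4)[OF assms] homeomorphic_map_maps by blast
  then have "continuous_map ?Y (subtopology X (chart_dom a)) g" "\<And>x. x \<in> chart_dom a \<Longrightarrow> g (chart_map a x) = x"
    using is_chartD(5)[OF assms] by (auto simp: homeomorphic_maps_def topspace_subtopology)
  then have "continuous_map ?Y X g" "\<And>e. e \<in> topspace ?Y \<Longrightarrow> g e = chart_inv a e"
    using chart_inv_left[OF assms] by (auto simp: continuous_map_in_subtopology)
  then show ?thesis by (rule continuous_map_eq)
qed

text \<open>Produces the compact sets of group elements used later: an annulus around \<one> and a
  closed coordinate ball around a nontrivial element.\<close>

lemma chart_compact_preimage:
  assumes "is_chart X a" "compact C" "C \<subseteq> chart_map a ` chart_dom a"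
  shows "compactin X {x \<in> chart_dom a. chart_map a x \<in> C}"
proof -
  have "compactin (top_of_set (chart_map a ` chart_dom a)) C"
    using assms(2,3) by (simp add: compactin_subtopology)
  then have "compactin X (chart_inv a ` C)"
    by (rule image_compactin[OF _ chart_inv_continuous[OF assms(1)]])
  moreover have "chart_inv a ` C = {x \<in> chart_dom a. chart_map a x \<in> C}"
    using assms(3) chart_inv_left[OF assms(1)] chart_inv_dom[of _ a] chart_inv_right[of _ a]
    by (force simp: image_iff subset_iff)
  ultimately show ?thesis by simp
qed

lemma openin_prod_topologyE:
  assumes "openin (prod_topology X Y) W" "(p, q) \<in> W"
  obtains U V where "openin X U" "openin Y V" "p \<in> U" "q \<in> V" "U \<times> V \<subseteq> W"
  using assms unfolding openin_prod_topology_alt by metis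

lemma is_chart_prod:
  assumes a: "is_chart X a" and b: "is_chart Y b"
  shows "is_chart (prod_topology X Y) (prod_chart a b)"
proof -
  have im: "(\<lambda>(x, y). (chart_map a x, chart_map b y)) ` (chart_dom a \<times> chart_dom b)
      = (chart_map a ` chart_dom a) \<times> (chart_map b ` chart_dom b)"
    by auto
  obtain f where f: "homeomorphic_maps (subtopology X (chart_dom a)) (top_of_set (chart_map a ` chart_dom a))
       (chart_map a) f"
    using is_chartD(4)[OF a] homeomorphic_map_maps by blast
  obtain g where g: "homeomorphic_maps (subtopology Y (chart_dom b)) (top_of_set (chart_map b ` chart_dom b))
       (chart_map b) g"
    using is_chartD(4)[OF b] homeomorphic_map_maps by blast
  have "homeomorphic_maps (prod_topology (subtopology X (chart_dom a)) (subtopology Y (chart_dom b)))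
     (prod_topology (top_of_set (chart_map a ` chart_dom a)) (top_of_set (chart_map b ` chart_dom b)))
     (\<lambda>(x, y). (chart_map a x, chart_map b y)) (\<lambda>(x, y). (f x, g y))"
    unfolding homeomorphic_maps_prod using f g by blast
  then have h: "homeomorphic_map (prod_topology (subtopology X (chart_dom a)) (subtopology Y (chart_dom b)))
     (prod_topology (top_of_set (chart_map a ` chart_dom a)) (top_of_set (chart_map b ` chart_dom b)))
     (\<lambda>(x, y). (chart_map a x, chart_map b y))"
    using homeomorphic_map_maps by blast
  then show ?thesis
    using is_chartD[OF a] is_chartD[OF b]
    by (simp add: is_chart_def prod_chart_def im subspace_Times openin_prod_Times_iff openin_Times
        subtopology_Times[symmetric])
qed

section \<open>Strict derivatives\<close>

text \<open>
  The maps live on the manifold itself and \<open>\<alpha>\<close> stands for the coordinates in the source, so that no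
  chart inverses occur. Only the values of \<open>D\<close> on the model space of the chart are determined.
\<close>

definition lin_approx ::
    "'m set \<Rightarrow> ('m \<Rightarrow> 'e::real_normed_vector) \<Rightarrow> ('m \<Rightarrow> 'f::real_normed_vector) \<Rightarrow> ('e \<Rightarrow> 'f) \<Rightarrow> real \<Rightarrow> bool" where
  "lin_approx U \<alpha> F D e \<longleftrightarrow>
     (\<forall>x\<in>U. \<forall>y\<in>U. norm (F x - F y - D (\<alpha> x - \<alpha> y)) \<le> e * norm (\<alpha> x - \<alpha> y))"

text \<open>Also known as the strong Frechet derivative. Since both points in
  \<open>lin_approx\<close> range freely over \<open>U\<close>, it yields a Lipschitz bound,
  restricts to slices of a product, and remains usable at base points near \<open>p\<close>.\<close>

definition strict_deriv ::
    "'m topology \<Rightarrow> ('m \<Rightarrow> 'e::real_normed_vector) \<Rightarrow> ('m \<Rightarrow> 'f::real_normed_vector) \<Rightarrow> 'm \<Rightarrow> ('e \<Rightarrow> 'f) \<Rightarrow> bool" where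
  "strict_deriv X \<alpha> F p D \<longleftrightarrow>
     bounded_linear D \<and> (\<forall>e>0. \<exists>U. openin X U \<and> p \<in> U \<and> lin_approx U \<alpha> F D e)"

lemma lin_approxD:
  "lin_approx U \<alpha> F D e \<Longrightarrow> x \<in> U \<Longrightarrow> y \<in> U \<Longrightarrow>
     norm (F x - F y - D (\<alpha> x - \<alpha> y)) \<le> e * norm (\<alpha> x - \<alpha> y)"
  by (simp add: lin_approx_def)

lemma strict_derivE:
  assumes "strict_deriv X \<alpha> F p D" "e > 0"
  obtains U where "openin X U" "p \<in> U" "lin_approx U \<alpha> F D e"
  using assms unfolding strict_deriv_def by blast

lemma strict_deriv_linear: "strict_deriv X \<alpha> F p D \<Longrightarrow> bounded_linear D"
  by (simp add: strict_deriv_def)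

lemma bounded_linear_bound:
  assumes "bounded_linear D"
  obtains L where "L > 0" "\<And>v. norm (D v) \<le> L * norm v"
  using bounded_linear.pos_bounded[OF assms] by (metis mult.commute)

lemma strict_deriv_lipschitz:
  assumes "strict_deriv X \<alpha> F p D"
  obtains L U where "L > 0" "openin X U" "p \<in> U"
    "\<And>x y. x \<in> U \<Longrightarrow> y \<in> U \<Longrightarrow> norm (F x - F y) \<le> L * norm (\<alpha> x - \<alpha> y)"
proof -
  obtain L where L: "L > 0" "\<And>v. norm (D v) \<le> L * norm v"
    using bounded_linear_bound[OF strict_deriv_linear[OF assms]] by blast
  obtain U where U: "openin X U" "p \<in> U" "lin_approx U \<alpha> F D 1"
    using strict_derivE[OF assms, of 1] by auto
  show ?thesis
  proof (rule that[of "L + 1" U])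
    fix x y assume "x \<in> U" "y \<in> U"
    then have "norm (F x - F y - D (\<alpha> x - \<alpha> y)) \<le> norm (\<alpha> x - \<alpha> y)"
      using lin_approxD[OF U(3)] by force
    moreover have "norm (F x - F y) \<le> norm (F x - F y - D (\<alpha> x - \<alpha> y)) + norm (D (\<alpha> x - \<alpha> y))"
      using norm_triangle_sub[of "F x - F y" "D (\<alpha> x - \<alpha> y)"] by simp
    ultimately show "norm (F x - F y) \<le> (L + 1) * norm (\<alpha> x - \<alpha> y)"
      using L(2)[of "\<alpha> x - \<alpha> y"] by (simp add: algebra_simps)
  qed (use L U in auto)
qed

text \<open>Both maps predict the same increment of \<open>F\<close> along a short ray, so they
  differ by at most the two errors. Fixed errors instead of derivatives are assumed because one of
  the maps may be the derivative at a different, nearby point.\<close>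

lemma lin_approx_compare:
  assumes a: "is_chart X a" and p: "p \<in> chart_dom a"
    and U: "openin X U" "p \<in> U" "lin_approx U (chart_map a) F D e"
    and V: "openin X V" "p \<in> V" "lin_approx V (chart_map a) F D' e'"
    and D: "bounded_linear D" "bounded_linear D'" and u: "u \<in> chart_model a"
  shows "norm (D u - D' u) \<le> (e + e') * norm u"
proof -
  have "openin X (U \<inter> V)" "p \<in> U \<inter> V" using U V by auto
  then obtain t x where t: "t > 0" and x: "x \<in> U" "x \<in> V" "chart_map a x = chart_map a p + t *\<^sub>R u"
    using chart_ray[OF a _ _ p u] by blast
  have 1: "norm (F x - F p - D (t *\<^sub>R u)) \<le> e * norm (t *\<^sub>R u)"
    using lin_approxD[OF U(3) x(1) U(2)] x(3) by simp
  have 2: "norm (F x - F p - D' (t *\<^sub>R u)) \<le> e' * norm (t *\<^sub>R u)"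
    using lin_approxD[OF V(3) x(2) V(2)] x(3) by simp
  have "norm (D (t *\<^sub>R u) - D' (t *\<^sub>R u))
      = norm ((F x - F p - D' (t *\<^sub>R u)) - (F x - F p - D (t *\<^sub>R u)))"
    by (simp add: algebra_simps)
  also have "\<dots> \<le> norm (F x - F p - D' (t *\<^sub>R u)) + norm (F x - F p - D (t *\<^sub>R u))"
    by (rule norm_triangle_ineq4)
  also have "\<dots> \<le> (e + e') * norm (t *\<^sub>R u)" using 1 2 by (simp add: algebra_simps)
  finally have "norm (t *\<^sub>R (D u - D' u)) \<le> (e + e') * norm (t *\<^sub>R u)"
    using D by (simp add: bounded_linear.linear linear_cmul scaleR_diff_right)
  then have "t * norm (D u - D' u) \<le> t * ((e + e') * norm u)" using t by (simp add: mult.left_commute)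
  then show ?thesis using t by simp
qed

lemma eq_by_epsilon:
  fixes v w :: "'a::real_normed_vector" and M :: real
  assumes "\<And>e. e > 0 \<Longrightarrow> norm (v - w) \<le> (e + e) * M"
  shows "v = w"
proof (rule ccontr)
  assume "v \<noteq> w"
  then have n: "norm (v - w) > 0" by simp
  then have "M > 0" using order_less_le_trans[OF n assms[OF zero_less_one]] by (simp add: zero_less_mult_iff)
  \<comment> \<open>With this value for \<open>e\<close>, the assumption bounds
    \<open>norm (v - w)\<close> by half of itself.\<close>
  then have "norm (v - w) / (4 * M) > 0" using n by simp
  from assms[OF this] have "norm (v - w) \<le> norm (v - w) / 2" using \<open>M > 0\<close> by (simp add: field_simps)
  then show False using n by simp
qed

lemma strict_deriv_unique:
  assumes a: "is_chart X a" and p: "p \<in> chart_dom a"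
    and D: "strict_deriv X (chart_map a) F p D" "strict_deriv X (chart_map a) F p D'"
    and u: "u \<in> chart_model a"
  shows "D u = D' u"
proof -
  have *: "norm (D u - D' u) \<le> (e + e) * norm u" if "e > 0" for e
    using strict_derivE[OF D(1) that] strict_derivE[OF D(2) that]
      lin_approx_compare[OF a p _ _ _ _ _ _ strict_deriv_linear[OF D(1)] strict_deriv_linear[OF D(2)] u]
    by metis
  then show ?thesis by (rule eq_by_epsilon)
qed

text \<open>Carries the metric immersion estimate for orbit maps over to their derivatives; the
  approximation error c/2 uses up half of the constant.\<close>

lemma strict_deriv_lower_bound:
  assumes a: "is_chart X a" and p: "p \<in> chart_dom a" and D: "strict_deriv X (chart_map a) F p D"
    and U: "openin X U" "p \<in> U" and c: "c > 0"
    and lb: "\<And>x. x \<in> U \<Longrightarrow> c * norm (chart_map a x - chart_map a p) \<le> norm (F x - F p)"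
    and u: "u \<in> chart_model a"
  shows "c / 2 * norm u \<le> norm (D u)"
proof -
  obtain V where V: "openin X V" "p \<in> V" "lin_approx V (chart_map a) F D (c / 2)"
    using strict_derivE[OF D, of "c / 2"] c by auto
  have "openin X (U \<inter> V)" "p \<in> U \<inter> V" using U V by auto
  then obtain t x where t: "t > 0" and x: "x \<in> U" "x \<in> V" "chart_map a x = chart_map a p + t *\<^sub>R u"
    using chart_ray[OF a _ _ p u] by blast
  have "norm (F x - F p - D (t *\<^sub>R u)) \<le> c / 2 * norm (t *\<^sub>R u)"
    using lin_approxD[OF V(3) x(2) V(2)] x(3) by simp
  moreover have "c * norm (t *\<^sub>R u) \<le> norm (F x - F p)" using lb[OF x(1)] x(3) by simp
  moreover have "norm (F x - F p) \<le> norm (F x - F p - D (t *\<^sub>R u)) + norm (D (t *\<^sub>R u))"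
    using norm_triangle_sub[of "F x - F p" "D (t *\<^sub>R u)"] by simp
  ultimately have "c / 2 * norm (t *\<^sub>R u) \<le> norm (D (t *\<^sub>R u))" by simp
  also have "D (t *\<^sub>R u) = t *\<^sub>R D u"
    using strict_deriv_linear[OF D] by (simp add: bounded_linear.linear linear_cmul)
  finally have "t * (c / 2 * norm u) \<le> t * norm (D u)" using t by (simp add: mult_ac)
  then show ?thesis using t by simp
qed

lemma strict_deriv_compose:
  assumes f: "continuous_map X Y f" and p: "p \<in> topspace X"
    and D: "strict_deriv X \<alpha> (\<beta> \<circ> f) p D" and D': "strict_deriv Y \<beta> F (f p) D'"
  shows "strict_deriv X \<alpha> (F \<circ> f) p (D' \<circ> D)"
  unfolding strict_deriv_def
proof (intro conjI allI impI)
  show "bounded_linear (D' \<circ> D)"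
    using strict_deriv_linear[OF D] strict_deriv_linear[OF D'] unfolding comp_def
    by (rule bounded_linear_compose[rotated])
  fix e :: real assume "e > 0"
  obtain L where L: "L > 0" "\<And>v. norm (D' v) \<le> L * norm v"
    using bounded_linear_bound[OF strict_deriv_linear[OF D']] by blast
  obtain M U where M: "M > 0" and U: "openin X U" "p \<in> U"
    "\<And>x y. x \<in> U \<Longrightarrow> y \<in> U \<Longrightarrow> norm ((\<beta> \<circ> f) x - (\<beta> \<circ> f) y) \<le> M * norm (\<alpha> x - \<alpha> y)"
    using strict_deriv_lipschitz[OF D] by metis
  \<comment> \<open>The error is split in half: \<open>L\<close> amplifies the error of the inner
    map, and \<open>M\<close> bounds the increments on which the outer error is measured.\<close>
  have "e / (2 * L) > 0" using \<open>e > 0\<close> L(1) by simp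
  then obtain V where V: "openin X V" "p \<in> V" "lin_approx V \<alpha> (\<beta> \<circ> f) D (e / (2 * L))"
    using strict_derivE[OF D] by metis
  have "e / (2 * M) > 0" using \<open>e > 0\<close> M by simp
  then obtain W where W: "openin Y W" "f p \<in> W" "lin_approx W \<beta> F D' (e / (2 * M))"
    using strict_derivE[OF D'] by metis
  define O' where "O' = U \<inter> V \<inter> {x \<in> topspace X. f x \<in> W}"
  have "openin X O'"
    unfolding O'_def using U V W f by (intro openin_Int openin_continuous_map_preimage) auto
  moreover have "p \<in> O'" using U V W p by (simp add: O'_def)
  moreover have "lin_approx O' \<alpha> (F \<circ> f) (D' \<circ> D) e"
    unfolding lin_approx_def
  proof (intro ballI)
    fix x y assume x: "x \<in> O'" and y: "y \<in> O'"
    let ?n = "norm (\<alpha> x - \<alpha> y)" let ?b = "\<beta> (f x) - \<beta> (f y)"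
    have 1: "norm (F (f x) - F (f y) - D' ?b) \<le> e / (2 * M) * norm ?b"
      using lin_approxD[OF W(3)] x y by (simp add: O'_def)
    have 2: "norm (?b - D (\<alpha> x - \<alpha> y)) \<le> e / (2 * L) * ?n"
      using lin_approxD[OF V(3), of x y] x y by (simp add: O'_def)
    have 3: "norm ?b \<le> M * ?n" using U(3) x y by (simp add: O'_def)
    have "norm (D' (?b - D (\<alpha> x - \<alpha> y))) \<le> L * (e / (2 * L) * ?n)"
      using L 2 by (meson mult_left_mono less_imp_le order_trans)
    then have 4: "norm (D' ?b - D' (D (\<alpha> x - \<alpha> y))) \<le> e / 2 * ?n"
      using L(1) strict_deriv_linear[OF D'] by (simp add: bounded_linear.linear linear_diff)
    have "norm (F (f x) - F (f y) - D' ?b) \<le> e / (2 * M) * (M * ?n)"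
      using order_trans[OF 1 mult_left_mono[OF 3]] M \<open>e > 0\<close> by simp
    then have 5: "norm (F (f x) - F (f y) - D' ?b) \<le> e / 2 * ?n" using M by simp
    have "norm (F (f x) - F (f y) - D' (D (\<alpha> x - \<alpha> y)))
        \<le> norm (F (f x) - F (f y) - D' ?b) + norm (D' ?b - D' (D (\<alpha> x - \<alpha> y)))"
      using norm_triangle_ineq[of "F (f x) - F (f y) - D' ?b" "D' ?b - D' (D (\<alpha> x - \<alpha> y))"] by simp
    then show "norm ((F \<circ> f) x - (F \<circ> f) y - (D' \<circ> D) (\<alpha> x - \<alpha> y)) \<le> e * ?n"
      using 4 5 by (simp add: algebra_simps)
  qed
  ultimately show "\<exists>U. openin X U \<and> p \<in> U \<and> lin_approx U \<alpha> (F \<circ> f) (D' \<circ> D) e" by blast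
qed

text \<open>Inside the chart domain \<open>lin_approx\<close> evaluates \<open>D\<close> only at
  model vectors. This allows replacing \<open>D\<close> by the identity on the whole ambient
  type.\<close>

lemma strict_deriv_cong:
  assumes a: "is_chart X a" and p: "p \<in> chart_dom a"
    and D: "strict_deriv X (chart_map a) F p D"
    and eq: "\<And>u. u \<in> chart_model a \<Longrightarrow> D u = D' u" and D': "bounded_linear D'"
  shows "strict_deriv X (chart_map a) F p D'"
  unfolding strict_deriv_def
proof (intro conjI allI impI D')
  fix e :: real assume "e > 0"
  then obtain U where U: "openin X U" "p \<in> U" "lin_approx U (chart_map a) F D e"
    using strict_derivE[OF D] by metis
  have "lin_approx (U \<inter> chart_dom a) (chart_map a) F D' e"
    using U(3) by (simp add: lin_approx_def eq[symmetric] chart_diff_model[OF a])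
  moreover have "openin X (U \<inter> chart_dom a)" using U(1) is_chartD(2)[OF a] by blast
  ultimately show "\<exists>U. openin X U \<and> p \<in> U \<and> lin_approx U (chart_map a) F D' e"
    using U(2) p by blast
qed

text \<open>\<open>Ck_on\<close> gives continuity of x \<mapsto> f' x v only for each fixed v in
  \<open>E\<close>. An orthonormal basis of \<open>E\<close> makes this uniform in v, and the mean
  value theorem on segments then shows that C^1 maps are strictly differentiable.\<close>

lemma Ck_on_1_strict:
  fixes h :: "'a::euclidean_space \<Rightarrow> 'b::euclidean_space"
  assumes E: "subspace E" and S: "openin (top_of_set E) S" and h: "Ck_on (Suc 0) E S h" and q: "q \<in> S"
  obtains D where "bounded_linear D"
    "\<And>e. e > 0 \<Longrightarrow> \<exists>r>0. ball q r \<inter> E \<subseteq> S \<and> lin_approx (ball q r \<inter> E) (\<lambda>x. x) h D e"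
proof -
  obtain f' where f': "\<And>x. x \<in> S \<Longrightarrow> (h has_derivative f' x) (at x within S)"
    and cont: "\<And>v. v \<in> E \<Longrightarrow> continuous_on S (\<lambda>x. f' x v)"
    using h by auto
  have bl: "bounded_linear (f' x)" if "x \<in> S" for x
    using f'[OF that] by (rule has_derivative_bounded_linear)
  obtain Bs where Bs: "Bs \<subseteq> E" "pairwise orthogonal Bs" "\<And>x. x \<in> Bs \<Longrightarrow> norm x = 1"
    "independent Bs" "span Bs = E"
    using orthonormal_basis_subspace[OF E] by metis
  have fin: "finite Bs" using Bs(4) by (rule independent_imp_finite)
  \<comment> \<open>Dominates the operator norm of f' z - f' q on \<open>E\<close>, and is
    continuous with value 0 at \<open>q\<close>.\<close>
  define w where "w z = (\<Sum>b\<in>Bs. norm (f' z b - f' q b))" for z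
  have w: "norm (f' z v - f' q v) \<le> w z * norm v" if "z \<in> S" "v \<in> E" for z v
  proof -
    have v: "v = (\<Sum>b\<in>Bs. (v \<bullet> b) *\<^sub>R b)"
      using orthonormal_basis_expand[OF Bs(2,3) _ fin, of v] that(2) Bs(5) by simp
    have "f' z v - f' q v = (\<Sum>b\<in>Bs. (v \<bullet> b) *\<^sub>R (f' z b - f' q b))"
      using bl[OF that(1)] bl[OF q] by (subst (1 2) v)
        (simp add: bounded_linear.linear linear_sum linear_cmul sum_subtractf scaleR_diff_right)
    also have "norm \<dots> \<le> (\<Sum>b\<in>Bs. norm ((v \<bullet> b) *\<^sub>R (f' z b - f' q b)))" by (rule norm_sum)
    also have "\<dots> \<le> (\<Sum>b\<in>Bs. norm v * norm (f' z b - f' q b))"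
    proof (rule sum_mono)
      fix b assume "b \<in> Bs"
      then have "\<bar>v \<bullet> b\<bar> \<le> norm v" using Cauchy_Schwarz_ineq2[of v b] Bs(3) by simp
      then show "norm ((v \<bullet> b) *\<^sub>R (f' z b - f' q b)) \<le> norm v * norm (f' z b - f' q b)"
        by (simp add: mult_right_mono)
    qed
    also have "\<dots> = w z * norm v" by (simp add: w_def sum_distrib_left mult.commute)
    finally show ?thesis .
  qed
  have cw: "continuous_on S w"
    unfolding w_def using Bs(1) by (intro continuous_intros cont) auto
  have wq: "w q = 0" by (simp add: w_def)
  obtain r0 where r0: "r0 > 0" "ball q r0 \<inter> E \<subseteq> S"
    using S q unfolding openin_contains_ball by blast
  show ?thesis
  proof (rule that[of "f' q"])
    show "bounded_linear (f' q)" using bl[OF q] .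
    fix e :: real assume "e > 0"
    then obtain d where d: "d > 0" "\<And>z. z \<in> S \<Longrightarrow> dist z q < d \<Longrightarrow> dist (w z) (w q) < e"
      using cw q unfolding continuous_on_iff by metis
    define r where "r = min r0 d"
    let ?B = "ball q r \<inter> E"
    have BS: "?B \<subseteq> S" using r0 by (auto simp: r_def)
    have we: "w z \<le> e" if "z \<in> ?B" for z
      using d(2)[of z] that BS wq by (auto simp: r_def dist_norm norm_minus_commute)
    have cB: "convex ?B" using E by (intro convex_Int convex_ball subspace_imp_convex)
    have "lin_approx ?B (\<lambda>x. x) h (f' q) e"
      unfolding lin_approx_def
    proof (intro ballI)
      fix x y assume x: "x \<in> ?B" and y: "y \<in> ?B"
      define p where "p t = y + t *\<^sub>R (x - y)" for t :: real
      have pB: "p t \<in> ?B" if "t \<in> {0..1}" for t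
      proof -
        have "p t = (1 - t) *\<^sub>R y + t *\<^sub>R x" by (simp add: p_def algebra_simps)
        then show ?thesis using convexD_alt[OF cB y x] that by simp
      qed
      have xy: "x - y \<in> E" using x y E by (auto intro: subspace_diff)
      \<comment> \<open>Subtracting the linear part turns k 1 - k 0 into the remainder of
        \<open>lin_approx\<close>, while the derivative of \<open>k\<close> becomes the small
        difference of f' (p t) and f' q.\<close>
      define k where "k t = h (p t) - t *\<^sub>R f' q (x - y)" for t
      have dp: "(p has_derivative (\<lambda>s. s *\<^sub>R (x - y))) (at t within T)" for t T
        unfolding p_def by (auto intro!: derivative_eq_intros)
      have dk: "(k has_derivative (\<lambda>s. f' (p t) (s *\<^sub>R (x - y)) - s *\<^sub>R f' q (x - y))) (at t within T)"
        if "t \<in> T" "T \<subseteq> {0..1}" for t T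
        unfolding k_def
      proof (rule has_derivative_diff)
        have "p ` T \<subseteq> S" using pB BS that(2) by blast
        then show "((\<lambda>t. h (p t)) has_derivative (\<lambda>s. f' (p t) (s *\<^sub>R (x - y)))) (at t within T)"
          using has_derivative_in_compose2[of S h f' p T t, OF f' _ that(1) dp] by blast
        show "((\<lambda>t. t *\<^sub>R f' q (x - y)) has_derivative (\<lambda>s. s *\<^sub>R f' q (x - y))) (at t within T)"
          by (auto intro!: derivative_eq_intros)
      qed
      have ck: "continuous_on {0..1} k"
        by (rule has_derivative_continuous_on) (rule dk, auto)
      have "\<exists>t\<in>{0<..<1}. norm (k 1 - k 0) \<le> norm (f' (p t) ((1 - 0) *\<^sub>R (x - y)) - (1 - 0) *\<^sub>R f' q (x - y))"
      proof (rule mvt_general[OF zero_less_one ck])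
        fix t :: real assume "0 < t" "t < 1"
        then show "(k has_derivative (\<lambda>s. f' (p t) (s *\<^sub>R (x - y)) - s *\<^sub>R f' q (x - y))) (at t)"
          using dk[of t "{0<..<1}"] at_within_open[of t "{0<..<1}"]
            greaterThanLessThan_subseteq_atLeastAtMost_iff[of 0 1 0 "1::real"] by simp
      qed
      then obtain t where t: "t \<in> {0<..<1}" "norm (k 1 - k 0) \<le> norm (f' (p t) (x - y) - f' q (x - y))"
        by auto
      have "p t \<in> ?B" using pB t(1) by simp
      have "norm (k 1 - k 0) \<le> w (p t) * norm (x - y)"
        using t(2) w[OF _ xy, of "p t"] \<open>p t \<in> ?B\<close> BS by force
      also have "\<dots> \<le> e * norm (x - y)"
        using we[OF \<open>p t \<in> ?B\<close>] by (rule mult_right_mono) simp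
      finally show "norm (h x - h y - f' q (x - y)) \<le> e * norm (x - y)"
        by (simp add: k_def p_def algebra_simps)
    qed
    moreover have "r > 0" using r0 d by (simp add: r_def)
    ultimately show "\<exists>r>0. ball q r \<inter> E \<subseteq> S \<and> lin_approx (ball q r \<inter> E) (\<lambda>x. x) h (f' q) e"
      using BS by blast
  qed
qed

lemma smooth_map_strict_deriv:
  assumes f: "smooth_map X A Y B f" and a: "a \<in> A" "is_chart X a" and b: "b \<in> B" "openin Y (chart_dom b)"
    and p: "p \<in> chart_dom a" "f p \<in> chart_dom b"
  obtains D where "strict_deriv X (chart_map a) (chart_map b \<circ> f) p D"
proof -
  let ?W = "{x \<in> chart_dom a. f x \<in> chart_dom b}"
  let ?S = "chart_map a ` ?W" let ?h = "chart_map b \<circ> f \<circ> chart_inv a"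
  have "?W = chart_dom a \<inter> {x \<in> topspace X. f x \<in> chart_dom b}"
    using is_chartD(5)[OF a(2)] by auto
  moreover have "openin X {x \<in> topspace X. f x \<in> chart_dom b}"
    using f b(2) by (intro openin_continuous_map_preimage) (auto simp: smooth_map_def)
  ultimately have W: "openin X ?W" using is_chartD(2)[OF a(2)] by auto
  then have S: "openin (top_of_set (chart_model a)) ?S" by (intro chart_open_image[OF a(2)]) auto
  have "Ck_on (Suc 0) (chart_model a) ?S ?h"
    using f a(1) b(1) by (simp add: smooth_map_def smooth_on_def del: Ck_on.simps)
  moreover have "chart_map a p \<in> ?S" using p by simp
  ultimately obtain D where D: "bounded_linear D"
    "\<And>e. e > 0 \<Longrightarrow> \<exists>r>0. ball (chart_map a p) r \<inter> chart_model a \<subseteq> ?S \<and>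
        lin_approx (ball (chart_map a p) r \<inter> chart_model a) (\<lambda>x. x) ?h D e"
    using Ck_on_1_strict[OF is_chartD(1)[OF a(2)] S] by blast
  have "strict_deriv X (chart_map a) (chart_map b \<circ> f) p D"
    unfolding strict_deriv_def
  proof (intro conjI allI impI D(1))
    fix e :: real assume "e > 0"
    then obtain r where r: "r > 0" "lin_approx (ball (chart_map a p) r \<inter> chart_model a) (\<lambda>x. x) ?h D e"
      using D(2) by blast
    let ?U = "{x \<in> chart_dom a. chart_map a x \<in> ball (chart_map a p) r}"
    have "openin X ?U" by (rule chart_open_vimage[OF a(2)]) simp
    moreover have "p \<in> ?U" using p r by simp
    moreover have "lin_approx ?U (chart_map a) (chart_map b \<circ> f) D e"
      unfolding lin_approx_def
    proof (intro ballI)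
      fix x y assume "x \<in> ?U" "y \<in> ?U"
      then show "norm ((chart_map b \<circ> f) x - (chart_map b \<circ> f) y - D (chart_map a x - chart_map a y))
          \<le> e * norm (chart_map a x - chart_map a y)"
        using lin_approxD[OF r(2), of "chart_map a x" "chart_map a y"]
          chart_inv_left[OF a(2)] chart_map_model[OF a(2)] by simp
    qed
    ultimately show "\<exists>U. openin X U \<and> p \<in> U \<and> lin_approx U (chart_map a) (chart_map b \<circ> f) D e"
      by blast
  qed
  then show ?thesis by (rule that)
qed

lemma strict_deriv_pair:
  assumes D: "strict_deriv (prod_topology X Y) (\<lambda>(x, y). (\<alpha> x, \<beta> y)) F (p, q) D"
  shows strict_deriv_pair_fst: "q \<in> topspace Y \<Longrightarrow> strict_deriv X \<alpha> (\<lambda>x. F (x, q)) p (\<lambda>u. D (u, 0))"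
    and strict_deriv_pair_snd: "p \<in> topspace X \<Longrightarrow> strict_deriv Y \<beta> (\<lambda>y. F (p, y)) q (\<lambda>v. D (0, v))"
proof -
  have bl: "bounded_linear D" using strict_deriv_linear[OF D] .
  show "strict_deriv X \<alpha> (\<lambda>x. F (x, q)) p (\<lambda>u. D (u, 0))"
    unfolding strict_deriv_def
  proof (intro conjI allI impI)
    show "bounded_linear (\<lambda>u. D (u, 0))"
      by (rule bounded_linear_compose[OF bl]) (intro bounded_linear_Pair bounded_linear_ident bounded_linear_zero)
    fix e :: real assume "e > 0"
    then obtain W where W: "openin (prod_topology X Y) W" "(p, q) \<in> W"
      "lin_approx W (\<lambda>(x, y). (\<alpha> x, \<beta> y)) F D e"
      using strict_derivE[OF D] by metis
    obtain U V where UV: "openin X U" "openin Y V" "p \<in> U" "q \<in> V" "U \<times> V \<subseteq> W"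
      using openin_prod_topologyE[OF W(1,2)] .
    have "norm (F (x, q) - F (y, q) - D (\<alpha> x - \<alpha> y, 0)) \<le> e * norm (\<alpha> x - \<alpha> y)" if "x \<in> U" "y \<in> U" for x y
      using lin_approxD[OF W(3), of "(x, q)" "(y, q)"] that UV by (auto simp: norm_Pair subset_iff)
    then show "\<exists>U. openin X U \<and> p \<in> U \<and> lin_approx U \<alpha> (\<lambda>x. F (x, q)) (\<lambda>u. D (u, 0)) e"
      using UV by (auto simp: lin_approx_def)
  qed
  show "strict_deriv Y \<beta> (\<lambda>y. F (p, y)) q (\<lambda>v. D (0, v))"
    unfolding strict_deriv_def
  proof (intro conjI allI impI)
    show "bounded_linear (\<lambda>u. D (0, u))"
      by (rule bounded_linear_compose[OF bl]) (intro bounded_linear_Pair bounded_linear_ident bounded_linear_zero)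
    fix e :: real assume "e > 0"
    then obtain W where W: "openin (prod_topology X Y) W" "(p, q) \<in> W"
      "lin_approx W (\<lambda>(x, y). (\<alpha> x, \<beta> y)) F D e"
      using strict_derivE[OF D] by metis
    obtain U V where UV: "openin X U" "openin Y V" "p \<in> U" "q \<in> V" "U \<times> V \<subseteq> W"
      using openin_prod_topologyE[OF W(1,2)] .
    have "norm (F (p, x) - F (p, y) - D (0, \<beta> x - \<beta> y)) \<le> e * norm (\<beta> x - \<beta> y)" if "x \<in> V" "y \<in> V" for x y
      using lin_approxD[OF W(3), of "(p, x)" "(p, y)"] that UV by (auto simp: norm_Pair subset_iff)
    then show "\<exists>U. openin Y U \<and> q \<in> U \<and> lin_approx U \<beta> (\<lambda>y. F (p, y)) (\<lambda>v. D (0, v)) e"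
      using UV by (auto simp: lin_approx_def)
  qed
qed

section \<open>Curves and tangent vectors\<close>

lemma Ck_on_cong:
  assumes "\<And>x. x \<in> S \<Longrightarrow> f x = g x" "Ck_on k E S f"
  shows "Ck_on k E S g"
proof (cases k)
  case 0
  then show ?thesis using assms continuous_on_cong[of S S f g] by simp
next
  case (Suc n)
  then obtain f' where f': "\<forall>x\<in>S. (f has_derivative f' x) (at x within S)" "\<forall>v\<in>E. Ck_on n E S (\<lambda>x. f' x v)"
    using assms(2) by auto
  have "(g has_derivative f' x) (at x within S)" if "x \<in> S" for x
    by (rule has_derivative_transform[OF that, where f = f]) (use assms(1) f'(1) that in auto)
  then show ?thesis using Suc f'(2) by auto
qed

lemma smooth_on_cong:
  "(\<And>x. x \<in> S \<Longrightarrow> f x = g x) \<Longrightarrow> smooth_on E S f \<Longrightarrow> smooth_on E S g"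
  unfolding smooth_on_def using Ck_on_cong by blast

text \<open>The induction generalizes over \<open>f\<close> because \<open>Ck_on\<close> recurses
  through the maps x \<mapsto> f' x v. The new derivative in direction s is f' in direction s v,
  which stays in \<open>E\<close>, so the induction hypothesis applies to it.\<close>

lemma Ck_on_line:
  assumes E: "subspace E" and v: "v \<in> E" and J: "\<And>t. t \<in> J \<Longrightarrow> p + t *\<^sub>R v \<in> S"
  shows "Ck_on k E S f \<Longrightarrow> Ck_on k UNIV J (\<lambda>t::real. f (p + t *\<^sub>R v))"
proof (induction k arbitrary: f)
  case 0
  then show ?case using J by (auto intro!: continuous_intros continuous_on_compose2[of S f])
next
  case (Suc k)
  then obtain f' where f': "\<And>x. x \<in> S \<Longrightarrow> (f has_derivative f' x) (at x within S)"
    and C: "\<And>v. v \<in> E \<Longrightarrow> Ck_on k E S (\<lambda>x. f' x v)"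
    by auto
  have "((\<lambda>t. f (p + t *\<^sub>R v)) has_derivative (\<lambda>s. f' (p + t *\<^sub>R v) (s *\<^sub>R v))) (at t within J)"
    if "t \<in> J" for t
  proof (rule has_derivative_in_compose2[of S f f'])
    show "((\<lambda>t. p + t *\<^sub>R v) has_derivative (\<lambda>s. s *\<^sub>R v)) (at t within J)"
      by (auto intro!: derivative_eq_intros)
  qed (use f' J that in auto)
  moreover have "Ck_on k UNIV J (\<lambda>t. f' (p + t *\<^sub>R v) (s *\<^sub>R v))" for s
    using Suc.IH[OF C] E v by (simp add: subspace_scale)
  ultimately show ?case
    unfolding Ck_on.simps by (intro exI[of _ "\<lambda>t s. f' (p + t *\<^sub>R v) (s *\<^sub>R v)"]) simp
qed

lemma is_chart_interval:
  assumes "a \<in> interval_atlas r"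
  shows "is_chart (top_of_set {-r<..<r}) a" "chart_map a = (\<lambda>t. t)" "chart_dom a = {-r<..<r}"
    "chart_model a = UNIV"
proof -
  show *: "chart_map a = (\<lambda>t. t)" "chart_dom a = {-r<..<r}" "chart_model a = UNIV"
    using assms by (auto simp: interval_atlas_def)
  have "homeomorphic_map (top_of_set {-r<..<r}) (top_of_set {-r<..<r}) (\<lambda>t. t)"
    using homeomorphic_map_id unfolding id_def by blast
  then show "is_chart (top_of_set {-r<..<r}) a"
    by (simp add: is_chart_def * subtopology_subtopology)
qed

lemma curve_strict_deriv:
  assumes c: "c \<in> curves_at X B x" and b: "b \<in> B" "is_chart X b" and x: "x \<in> chart_dom b"
  obtains D r where "r > 0" "continuous_map (top_of_set {-r<..<r}) X c"
    "strict_deriv (top_of_set {-r<..<r}) (\<lambda>t. t) (chart_map b \<circ> c) 0 D"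
proof -
  obtain r where r: "r > 0" "smooth_map (top_of_set {-r<..<r}) (interval_atlas r) X B c" and "c 0 = x"
    using c by (auto simp: curves_at_def)
  obtain a where a: "a \<in> interval_atlas r" by (auto simp: interval_atlas_def)
  have "0 \<in> chart_dom a" "c 0 \<in> chart_dom b"
    using r(1) x \<open>c 0 = x\<close> is_chart_interval[OF a] by auto
  then obtain D where "strict_deriv (top_of_set {-r<..<r}) (chart_map a) (chart_map b \<circ> c) 0 D"
    by (rule smooth_map_strict_deriv[OF r(2) a is_chart_interval(1)[OF a] b(1) is_chartD(2)[OF b(2)]])
  then show ?thesis
    using that r is_chart_interval[OF a] by (simp add: smooth_map_def)
qed

lemma strict_deriv_vector_derivative:
  fixes F :: "real \<Rightarrow> 'a::real_normed_vector"
  assumes D: "strict_deriv (top_of_set {-r<..<r}) (\<lambda>t. t) F 0 D" and r: "r > 0"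
  shows "vector_derivative F (at 0) = D 1"
proof -
  have "(F has_derivative D) (at 0)"
    unfolding has_derivative_at_alt
  proof (intro conjI allI impI)
    show bl: "bounded_linear D" using strict_deriv_linear[OF D] .
    fix e :: real assume "e > 0"
    then obtain U where U: "openin (top_of_set {-r<..<r}) U" "0 \<in> U" "lin_approx U (\<lambda>t. t) F D e"
      using strict_derivE[OF D] by metis
    have "open U" using U(1) openin_open_eq[of "{-r<..<r}" U] by simp
    then obtain d where d: "d > 0" "ball 0 d \<subseteq> U" using U(2) open_contains_ball by blast
    then have "\<forall>y. norm (y - 0) < d \<longrightarrow> norm (F y - F 0 - D (y - 0)) \<le> e * norm (y - 0)"
      using lin_approxD[OF U(3) _ U(2)] by (auto simp: subset_iff)
    then show "\<exists>d>0. \<forall>y. norm (y - 0) < d \<longrightarrow> norm (F y - F 0 - D (y - 0)) \<le> e * norm (y - 0)"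
      using d(1) by blast
  qed
  moreover have "D = (\<lambda>s. s *\<^sub>R D 1)"
  proof
    fix s show "D s = s *\<^sub>R D 1"
      using linear_cmul[OF bounded_linear.linear[OF strict_deriv_linear[OF D]], of s 1] by simp
  qed
  ultimately show ?thesis
    by (intro vector_derivative_at) (simp add: has_vector_derivative_def)
qed

lemma equiv_tangent_rel: "equiv (curves_at X B x) (tangent_rel X B x)"
  unfolding equiv_def refl_on_def sym_def trans_def tangent_rel_def by auto

context smooth_manifold begin

text \<open>Straight coordinate lines show that the tangent space defined by curves is large enough:
  a condition on all tangent vectors thereby constrains the derivative on the entire model
  space.\<close>

lemma line_in_curves_at:
  assumes a: "a \<in> A" and x: "x \<in> chart_dom a" and v: "v \<in> chart_model a"
  obtains c where "c \<in> curves_at X A x" "vector_derivative (chart_map a \<circ> c) (at 0) = v"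
proof -
  note ch = charts[OF a]
  have sub: "subspace (chart_model a)" using is_chartD(1)[OF ch] .
  obtain r0 where r0: "r0 > 0" "cball (chart_map a x) r0 \<inter> chart_model a \<subseteq> chart_map a ` chart_dom a"
    using is_chartD(3)[OF ch] x unfolding openin_contains_cball by blast
  define r where "r = r0 / (norm v + 1)"
  have n1: "0 < norm v + 1" using norm_ge_zero[of v] by linarith
  then have r: "r > 0" using r0 by (simp add: r_def)
  define l where "l t = chart_map a x + t *\<^sub>R v" for t :: real
  have l: "l t \<in> chart_map a ` chart_dom a" if "t \<in> {-r<..<r}" for t
  proof -
    have "\<bar>t\<bar> * norm v \<le> r * (norm v + 1)"
      using that r by (intro mult_mono) auto
    then have "\<bar>t\<bar> * norm v \<le> r0" using n1 by (simp add: r_def)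
    moreover have "l t \<in> chart_model a"
      using sub v chart_map_model[OF ch x] by (simp add: l_def subspace_add subspace_scale)
    ultimately show ?thesis using r0(2) by (auto simp: l_def dist_norm)
  qed
  define c where "c t = chart_inv a (l t)" for t
  have ac: "chart_map a (c t) = l t" "c t \<in> chart_dom a" if "t \<in> {-r<..<r}" for t
    using l[OF that] chart_inv_right[of _ a] chart_inv_dom[of _ a] by (auto simp: c_def)
  have "smooth_map (top_of_set {-r<..<r}) (interval_atlas r) X A c"
    unfolding smooth_map_def
  proof (intro conjI ballI)
    have "continuous_map (top_of_set {-r<..<r}) (top_of_set (chart_map a ` chart_dom a)) l"
      using l by (auto simp: continuous_map_in_subtopology l_def intro!: continuous_intros)
    then have "continuous_map (top_of_set {-r<..<r}) X (chart_inv a \<circ> l)"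
      using chart_inv_continuous[OF ch] by (rule continuous_map_compose)
    then show "continuous_map (top_of_set {-r<..<r}) X c" by (simp add: comp_def c_def[abs_def])
  next
    fix i b assume i: "i \<in> interval_atlas r" and b: "b \<in> A"
    note I = is_chart_interval[OF i]
    let ?J = "{t \<in> {-r<..<r}. c t \<in> chart_dom b}"
    have "smooth_on UNIV ?J (\<lambda>t. (chart_map b \<circ> chart_inv a) (chart_map a x + t *\<^sub>R v))"
      unfolding smooth_on_def
    proof (intro allI Ck_on_line[OF sub v])
      fix k show "Ck_on k (chart_model a) (chart_map a ` (chart_dom a \<inter> chart_dom b)) (chart_map b \<circ> chart_inv a)"
        using compatible[OF a b] by (simp add: smooth_compatible_def smooth_on_def)
      fix t assume "t \<in> ?J"
      then show "chart_map a x + t *\<^sub>R v \<in> chart_map a ` (chart_dom a \<inter> chart_dom b)"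
        using ac[of t] by (auto simp: l_def[symmetric] image_iff intro!: bexI[of _ "c t"])
    qed
    then have "smooth_on UNIV ?J (chart_map b \<circ> c \<circ> chart_inv i)"
      by (rule smooth_on_cong[rotated]) (use chart_inv_left[OF I(1)] I in \<open>auto simp: c_def l_def\<close>)
    then show "smooth_on (chart_model i) (chart_map i ` {t \<in> chart_dom i. c t \<in> chart_dom b})
          (chart_map b \<circ> c \<circ> chart_inv i)"
      by (simp add: I)
  qed
  moreover have "c 0 = x" using chart_inv_left[OF ch x] by (simp add: c_def l_def)
  ultimately have c: "c \<in> curves_at X A x" using r by (auto simp: curves_at_def)
  have "(l has_vector_derivative v) (at 0)"
    unfolding l_def by (auto intro!: derivative_eq_intros)
  then have "((chart_map a \<circ> c) has_vector_derivative v) (at 0)"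
    by (rule has_vector_derivative_transform_within_open[of _ _ _ "{-r<..<r}"]) (use r ac in auto)
  then show ?thesis using c that vector_derivative_at by blast
qed

text \<open>By the chain rule the velocity of f \<circ> c' is \<open>D\<close> applied to the
  velocity of c'. Choosing c' with velocity \<open>v\<close> and f \<circ> c' equivalent to a curve
  of velocity \<open>v\<close> gives the claim.\<close>

lemma differential_fixed_vector:
  assumes a: "a \<in> A" and x: "x \<in> chart_dom a"
    and stab: "\<forall>v\<in>tangent_space X A x. differential X A f x v = v"
  shows differential_fixed_point: "f x = x"
    and differential_strict_deriv_id:
      "\<lbrakk>strict_deriv X (chart_map a) (chart_map a \<circ> f) x D; v \<in> chart_model a\<rbrakk> \<Longrightarrow> D v = v"
proof -
  note ch = charts[OF a]
  have *: "\<exists>c \<in> curves_at X A x. vector_derivative (chart_map a \<circ> c) (at 0) = v \<and>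
      f x = x \<and> vector_derivative (chart_map a \<circ> (f \<circ> c)) (at 0) = v" if v: "v \<in> chart_model a" for v
  proof -
    obtain c where c: "c \<in> curves_at X A x" "vector_derivative (chart_map a \<circ> c) (at 0) = v"
      using line_in_curves_at[OF a x v] .
    let ?w = "tangent_rel X A x `` {c}"
    have "?w \<in> tangent_space X A x" using c(1) by (simp add: tangent_space_def quotientI)
    then have "differential X A f x ?w = ?w" using stab by blast
    moreover have "c \<in> ?w" using c(1) equiv_tangent_rel[of X A x] by (meson equiv_class_self)
    ultimately have "c \<in> differential X A f x ?w" by simp
    \<comment> \<open>\<open>differential\<close> is a union over representatives, so membership of
      \<open>c\<close> only provides some representative c' whose image is equivalent to
      \<open>c\<close>. Comparing values at 0 identifies the base points.\<close>
    then obtain c' where c': "(c, c') \<in> tangent_rel X A x" "(f \<circ> c', c) \<in> tangent_rel X A (f x)"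
      by (auto simp: differential_def)
    have "c 0 = x" "c 0 = f x" using c(1) c'(2) by (auto simp: tangent_rel_def curves_at_def)
    then have fx: "f x = x" by simp
    have "c' \<in> curves_at X A x" "vector_derivative (chart_map a \<circ> c') (at 0) = v"
      using c'(1) a x c(2) by (auto simp: tangent_rel_def)
    moreover have "vector_derivative (chart_map a \<circ> (f \<circ> c')) (at 0) = v"
      using c'(2) a x c(2) fx by (auto simp: tangent_rel_def)
    ultimately show ?thesis using fx by blast
  qed
  \<comment> \<open>The zero vector lies in every model, even a zero-dimensional one, so there is
    always a tangent vector to test.\<close>
  show "f x = x" using *[OF subspace_0[OF is_chartD(1)[OF ch]]] by blast
  assume D: "strict_deriv X (chart_map a) (chart_map a \<circ> f) x D" and v: "v \<in> chart_model a"
  obtain c' where c'x: "c' \<in> curves_at X A x" and fx: "f x = x"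
    and d': "vector_derivative (chart_map a \<circ> c') (at 0) = v"
    and fd': "vector_derivative (chart_map a \<circ> (f \<circ> c')) (at 0) = v"
    using *[OF v] by blast
  have c0: "c' 0 = x" using c'x by (simp add: curves_at_def)
  obtain D' r where r: "r > 0" "continuous_map (top_of_set {-r<..<r}) X c'"
    and D': "strict_deriv (top_of_set {-r<..<r}) (\<lambda>t. t) (chart_map a \<circ> c') 0 D'"
    using curve_strict_deriv[OF c'x a ch x] .
  have v': "D' 1 = v" using strict_deriv_vector_derivative[OF D' r(1)] d' by simp
  have "strict_deriv (top_of_set {-r<..<r}) (\<lambda>t. t) ((chart_map a \<circ> f) \<circ> c') 0 (D \<circ> D')"
    by (rule strict_deriv_compose[OF r(2) _ D']) (use r c0 D in auto)
  from strict_deriv_vector_derivative[OF this r(1)]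
  have "vector_derivative (chart_map a \<circ> (f \<circ> c')) (at 0) = D v" by (simp add: v' comp_assoc)
  then show "D v = v" using fd' by simp
qed

text \<open>For f = \<open>\<phi> \<one>\<close>, which is the identity only on the manifold. Curves
  are total functions, so f \<circ> c agrees with c only near 0 and equivalence replaces equality.
  This puts \<one> into every tangent stabilizer, so one that differs from {\<one>} has a nontrivial
  element.\<close>

lemma differential_id:
  assumes f: "\<And>y. y \<in> topspace X \<Longrightarrow> f y = y" and x: "x \<in> topspace X" and v: "v \<in> tangent_space X A x"
  shows "differential X A f x v = v"
proof -
  have *: "(f \<circ> c, c) \<in> tangent_rel X A x" if c: "c \<in> curves_at X A x" for c
  proof -
    obtain r where r: "r > 0" "smooth_map (top_of_set {-r<..<r}) (interval_atlas r) X A c" and c0: "c 0 = x"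
      using c by (auto simp: curves_at_def)
    have ct: "c t \<in> topspace X" if "t \<in> {-r<..<r}" for t
      using r(2) that by (auto simp: smooth_map_def continuous_map_def)
    have fc: "(f \<circ> c) t = c t" if "t \<in> {-r<..<r}" for t using f ct that by simp
    have "smooth_map (top_of_set {-r<..<r}) (interval_atlas r) X A (f \<circ> c)"
      unfolding smooth_map_def
    proof (intro conjI ballI)
      show "continuous_map (top_of_set {-r<..<r}) X (f \<circ> c)"
        by (rule continuous_map_eq[of _ _ c]) (use r(2) fc in \<open>auto simp: smooth_map_def\<close>)
      fix i b assume i: "i \<in> interval_atlas r" and b: "b \<in> A"
      note I = is_chart_interval[OF i]
      have eq: "{t \<in> chart_dom i. (f \<circ> c) t \<in> chart_dom b} = {t \<in> chart_dom i. c t \<in> chart_dom b}"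
        using fc I by auto
      have "smooth_on (chart_model i) (chart_map i ` {t \<in> chart_dom i. c t \<in> chart_dom b})
          (chart_map b \<circ> c \<circ> chart_inv i)"
        using r(2) i b by (auto simp: smooth_map_def)
      then show "smooth_on (chart_model i) (chart_map i ` {t \<in> chart_dom i. (f \<circ> c) t \<in> chart_dom b})
          (chart_map b \<circ> (f \<circ> c) \<circ> chart_inv i)"
        unfolding eq
        by (rule smooth_on_cong[rotated]) (use chart_inv_left[OF I(1)] I fc in auto)
    qed
    then have 1: "f \<circ> c \<in> curves_at X A x" using r(1) c0 f x by (auto simp: curves_at_def)
    have "vector_derivative (chart_map b \<circ> (f \<circ> c)) (at 0) = vector_derivative (chart_map b \<circ> c) (at 0)" for b
    proof (rule vector_derivative_cong_eq)
      have "\<forall>\<^sub>F t in nhds 0. t \<in> {-r<..<r}" using r(1) by (intro eventually_nhds_in_open) auto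
      then show "\<forall>\<^sub>F t in nhds 0. t \<in> UNIV \<longrightarrow> (chart_map b \<circ> (f \<circ> c)) t = (chart_map b \<circ> c) t"
        by eventually_elim (use fc in auto)
    qed auto
    then show ?thesis using 1 c by (auto simp: tangent_rel_def)
  qed
  obtain c0 where c0: "c0 \<in> curves_at X A x" "v = tangent_rel X A x `` {c0}"
    using v by (auto simp: tangent_space_def elim: quotientE)
  have "tangent_rel X A x `` {f \<circ> c} = v" if "c \<in> v" for c
  proof -
    have "(c0, c) \<in> tangent_rel X A x" using that c0 by auto
    moreover from this have "c \<in> curves_at X A x" by (auto simp: tangent_rel_def)
    ultimately have "(c0, f \<circ> c) \<in> tangent_rel X A x"
      using *[of c] equiv_tangent_rel[of X A x] by (meson equivE symE transE)
    then show ?thesis using c0(2) equiv_class_eq[OF equiv_tangent_rel] by metis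
  qed
  moreover have "c0 \<in> v" using c0 equiv_tangent_rel[of X A x] by (metis equiv_class_self)
  ultimately show ?thesis using f[OF x] by (auto simp: differential_def)
qed

end

section \<open>Continuity and strict differentiability of multiplication and action\<close>

context smooth_action begin

lemma T_chart: "a \<in> A \<Longrightarrow> is_chart T a"
  and X_chart: "b \<in> B \<Longrightarrow> is_chart X b"
  using smooth_manifold.charts smooth_manifold_axioms lie_group_axioms lie_group.axioms(2) by blast+

lemma T_cover: "g \<in> carrier G \<Longrightarrow> \<exists>a\<in>A. g \<in> chart_dom a"
  using smooth_manifold.covering[OF lie_group.axioms(2)[OF lie_group_axioms]] topspace_eq by auto

lemma X_cover: "x \<in> topspace X \<Longrightarrow> \<exists>b\<in>B. x \<in> chart_dom b"
  using smooth_manifold.covering[OF smooth_manifold_axioms] by auto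

lemma T_Hausdorff: "Hausdorff_space T" and T_second_countable: "second_countable T"
  using smooth_manifold.Hausdorff smooth_manifold.second_countable lie_group.axioms(2)[OF lie_group_axioms] by blast+

lemma act_one: "x \<in> topspace X \<Longrightarrow> \<phi> \<one> x = x"
  using id_eq_one by (metis restrict_apply')

lemma act_mult:
  "x \<in> topspace X \<Longrightarrow> g \<in> carrier G \<Longrightarrow> h \<in> carrier G \<Longrightarrow> \<phi> (g \<otimes> h) x = \<phi> g (\<phi> h x)"
  by (rule composition_rule)

lemma act_continuous: "continuous_map (prod_topology T X) X (\<lambda>(g, x). \<phi> g x)"
  using smooth_act by (simp add: smooth_map_def)

lemma mult_continuous: "continuous_map (prod_topology T T) T (\<lambda>(g, h). g \<otimes> h)"
  using smooth_mult by (simp add: smooth_map_def)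

lemma act_continuous_left: "x \<in> topspace X \<Longrightarrow> continuous_map T X (\<lambda>g. \<phi> g x)"
  using continuous_map_compose[OF _ act_continuous, of T "\<lambda>g. (g, x)"]
  by (simp add: comp_def continuous_map_pairedI)

lemma mult_continuous_right: "g \<in> carrier G \<Longrightarrow> continuous_map T T (\<lambda>h. g \<otimes> h)"
  using continuous_map_compose[OF _ mult_continuous, of T "\<lambda>h. (g, h)"]
  by (simp add: comp_def continuous_map_pairedI topspace_eq)

lemma act_strict_deriv:
  assumes "a \<in> A" "b \<in> B" "b' \<in> B" "g \<in> chart_dom a" "x \<in> chart_dom b" "\<phi> g x \<in> chart_dom b'"
  obtains D where "strict_deriv (prod_topology T X) (\<lambda>(g, x). (chart_map a g, chart_map b x))
      (\<lambda>(g, x). chart_map b' (\<phi> g x)) (g, x) D"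
proof -
  have "prod_chart a b \<in> prod_atlas A B" using assms by (auto simp: prod_atlas_def)
  moreover have "is_chart (prod_topology T X) (prod_chart a b)"
    using assms by (intro is_chart_prod T_chart X_chart)
  moreover have "openin X (chart_dom b')" using is_chartD(2)[OF X_chart[OF assms(3)]] .
  moreover have "(g, x) \<in> chart_dom (prod_chart a b)" "(\<lambda>(g, x). \<phi> g x) (g, x) \<in> chart_dom b'"
    using assms by (auto simp: prod_chart_def)
  ultimately obtain D where "strict_deriv (prod_topology T X) (chart_map (prod_chart a b))
      (chart_map b' \<circ> (\<lambda>(g, x). \<phi> g x)) (g, x) D"
    using smooth_map_strict_deriv[OF smooth_act _ _ assms(3)] by blast
  moreover have "chart_map b' \<circ> (\<lambda>(g, x). \<phi> g x) = (\<lambda>(g, x). chart_map b' (\<phi> g x))" by auto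
  ultimately show ?thesis using that by (simp add: prod_chart_def)
qed

lemma mult_strict_deriv:
  assumes "a \<in> A" "b \<in> A" "b' \<in> A" "g \<in> chart_dom a" "h \<in> chart_dom b" "g \<otimes> h \<in> chart_dom b'"
  obtains D where "strict_deriv (prod_topology T T) (\<lambda>(g, h). (chart_map a g, chart_map b h))
      (\<lambda>(g, h). chart_map b' (g \<otimes> h)) (g, h) D"
proof -
  have "prod_chart a b \<in> prod_atlas A A" using assms by (auto simp: prod_atlas_def)
  moreover have "is_chart (prod_topology T T) (prod_chart a b)"
    using assms by (intro is_chart_prod T_chart)
  moreover have "openin T (chart_dom b')" using is_chartD(2)[OF T_chart[OF assms(3)]] .
  moreover have "(g, h) \<in> chart_dom (prod_chart a b)" "(\<lambda>(g, h). g \<otimes> h) (g, h) \<in> chart_dom b'"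
    using assms by (auto simp: prod_chart_def)
  ultimately obtain D where "strict_deriv (prod_topology T T) (chart_map (prod_chart a b))
      (chart_map b' \<circ> (\<lambda>(g, h). g \<otimes> h)) (g, h) D"
    using smooth_map_strict_deriv[OF smooth_mult _ _ assms(3)] by blast
  moreover have "chart_map b' \<circ> (\<lambda>(g, h). g \<otimes> h) = (\<lambda>(g, h). chart_map b' (g \<otimes> h))" by auto
  ultimately show ?thesis using that by (simp add: prod_chart_def)
qed

section \<open>Orbit maps of locally free actions\<close>

text \<open>
  If \<open>\<phi> g x\<close> were too close to \<open>x\<close> for some \<open>g\<close> near \<open>\<one>\<close>, then the powers of \<open>g\<close>, which move
  almost linearly in the chart, would reach the compact annulus \<open>R\<close> around \<open>\<one>\<close> while still moving \<open>x\<close>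
  by less than the minimum \<open>q0\<close> over \<open>R\<close>. This replaces the one-parameter subgroups.
\<close>

lemma orbit_map_lower_bound_one:
  assumes lf: "locally_free G T X \<phi>"
    and a: "a \<in> A" "\<one> \<in> chart_dom a" and b: "b \<in> B" and x: "x \<in> chart_dom b"
  obtains c U where "c > 0" "openin T U" "\<one> \<in> U"
    "\<And>g. g \<in> U \<Longrightarrow> c * norm (chart_map a g - chart_map a \<one>) \<le> norm (chart_map b (\<phi> g x) - chart_map b x)"
proof -
  note cha = T_chart[OF a(1)] and chb = X_chart[OF b]
  have xX: "x \<in> topspace X" using x is_chartD(5)[OF chb] by auto
  define N where "N k = norm (chart_map a k - chart_map a \<one>)" for k
  define q where "q k = norm (chart_map b (\<phi> k x) - chart_map b x)" for k
  have one_stab: "\<one> \<in> stabilizer G \<phi> x" using act_one[OF xX] by (simp add: stabilizer_def)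
  have "openin (subtopology T (stabilizer G \<phi> x)) {\<one>}"
    using lf xX one_stab by (simp add: locally_free_def)
  then obtain U1 where U1: "openin T U1" "U1 \<inter> stabilizer G \<phi> x = {\<one>}"
    unfolding openin_subtopology by metis
  obtain D where D: "strict_deriv (prod_topology T T) (\<lambda>(g, h). (chart_map a g, chart_map a h))
      (\<lambda>(g, h). chart_map a (g \<otimes> h)) (\<one>, \<one>) D"
    using mult_strict_deriv[OF a(1) a(1) a(1) a(2) a(2)] a(2) by (metis l_one one_closed)
  \<comment> \<open>Two errors with factor 1/4 add up to the factor 1/2 in
    \<open>mult_est\<close>.\<close>
  then obtain W where W: "openin (prod_topology T T) W" "(\<one>, \<one>) \<in> W"
    "lin_approx W (\<lambda>(g, h). (chart_map a g, chart_map a h)) (\<lambda>(g, h). chart_map a (g \<otimes> h)) D (1/4)"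
    using strict_derivE[OF D zero_less_divide_1_iff[THEN iffD2, OF zero_less_numeral]] by metis
  obtain U2 V2 where UV2: "openin T U2" "openin T V2" "\<one> \<in> U2" "\<one> \<in> V2" "U2 \<times> V2 \<subseteq> W"
    using openin_prod_topologyE[OF W(1,2)] .
  have "openin (prod_topology T T) {p \<in> topspace (prod_topology T T). (\<lambda>(g, h). g \<otimes> h) p \<in> chart_dom a}"
    by (rule openin_continuous_map_preimage[OF mult_continuous is_chartD(2)[OF cha]])
  moreover have "(\<one>, \<one>) \<in> {p \<in> topspace (prod_topology T T). (\<lambda>(g, h). g \<otimes> h) p \<in> chart_dom a}"
    using a(2) by (simp add: topspace_eq)
  ultimately obtain U3 V3 where UV3: "openin T U3" "openin T V3" "\<one> \<in> U3" "\<one> \<in> V3"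
    "U3 \<times> V3 \<subseteq> {p \<in> topspace (prod_topology T T). (\<lambda>(g, h). g \<otimes> h) p \<in> chart_dom a}"
    by (rule openin_prod_topologyE)
  have "\<phi> \<one> x \<in> chart_dom b" using x act_one[OF xX] by simp
  then obtain D' where D': "strict_deriv (prod_topology T X) (\<lambda>(g, x). (chart_map a g, chart_map b x))
      (\<lambda>(g, x). chart_map b (\<phi> g x)) (\<one>, x) D'"
    using act_strict_deriv[OF a(1) b b a(2) x] by metis
  obtain L W' where L: "L > 0" and W': "openin (prod_topology T X) W'" "(\<one>, x) \<in> W'"
    and lip: "\<And>p p'. p \<in> W' \<Longrightarrow> p' \<in> W' \<Longrightarrow>
       norm ((\<lambda>(g, x). chart_map b (\<phi> g x)) p - (\<lambda>(g, x). chart_map b (\<phi> g x)) p')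
       \<le> L * norm ((\<lambda>(g, x). (chart_map a g, chart_map b x)) p - (\<lambda>(g, x). (chart_map a g, chart_map b x)) p')"
    using strict_deriv_lipschitz[OF D'] by metis
  obtain U4 V4 where UV4: "openin T U4" "openin X V4" "\<one> \<in> U4" "x \<in> V4" "U4 \<times> V4 \<subseteq> W'"
    using openin_prod_topologyE[OF W'] .
  define U5 where "U5 = {k \<in> topspace T. \<phi> k x \<in> V4 \<inter> chart_dom b}"
  have "openin T U5" unfolding U5_def
    by (rule openin_continuous_map_preimage[OF act_continuous_left[OF xX] openin_Int[OF UV4(2) is_chartD(2)[OF chb]]])
  moreover have "\<one> \<in> U5" using UV4(4) x act_one[OF xX] topspace_eq by (simp add: U5_def)
  ultimately have U5: "openin T U5" "\<one> \<in> U5" by auto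
  define U where "U = U1 \<inter> U2 \<inter> V2 \<inter> U3 \<inter> V3 \<inter> U4 \<inter> U5 \<inter> chart_dom a"
  have "openin T U"
    unfolding U_def using U1 UV2 UV3 UV4 U5 is_chartD(2)[OF cha] by (intro openin_Int)
  moreover have "\<one> \<in> U"
    unfolding U_def using U1 UV2 UV3 UV4 U5 a(2) by auto
  ultimately have U: "openin T U" "\<one> \<in> U" by auto
  have UG: "U \<subseteq> carrier G" using openin_subset[OF U(1)] topspace_eq by simp
  have mult_dom: "h \<otimes> g \<in> chart_dom a" if "h \<in> U" "g \<in> U" for h g
    using UV3(5) that by (auto simp: U_def)
  \<comment> \<open>The increments caused by \<open>g\<close> at \<open>h\<close> and at \<one> are
    both compared with D (0, _), which cancels without being computed.\<close>
  have mult_est: "norm (chart_map a (h \<otimes> g) - chart_map a h - (chart_map a g - chart_map a \<one>)) \<le> N g / 2"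
    if "h \<in> U" "g \<in> U" for h g
  proof -
    have "(h, g) \<in> W" "(h, \<one>) \<in> W" "(\<one>, g) \<in> W" "(\<one>, \<one>) \<in> W"
      using UV2 that by (auto simp: U_def)
    then have 1: "norm (chart_map a (h \<otimes> g) - chart_map a (h \<otimes> \<one>) - D (0, chart_map a g - chart_map a \<one>)) \<le> 1/4 * N g"
      and 2: "norm (chart_map a (\<one> \<otimes> g) - chart_map a (\<one> \<otimes> \<one>) - D (0, chart_map a g - chart_map a \<one>)) \<le> 1/4 * N g"
      using lin_approxD[OF W(3), of "(h, g)" "(h, \<one>)"] lin_approxD[OF W(3), of "(\<one>, g)" "(\<one>, \<one>)"]
      by (simp_all add: N_def norm_Pair)
    have "norm (chart_map a (h \<otimes> g) - chart_map a h - (chart_map a g - chart_map a \<one>))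
       = norm ((chart_map a (h \<otimes> g) - chart_map a h - D (0, chart_map a g - chart_map a \<one>))
          - (chart_map a g - chart_map a \<one> - D (0, chart_map a g - chart_map a \<one>)))"
      by (simp add: algebra_simps)
    also have "\<dots> \<le> 1/4 * N g + 1/4 * N g"
    proof (rule order_trans[OF norm_triangle_ineq4 add_mono])
      have "h \<in> carrier G" "g \<in> carrier G" using that UG by auto
      then show "norm (chart_map a (h \<otimes> g) - chart_map a h - D (0, chart_map a g - chart_map a \<one>)) \<le> 1/4 * N g"
        "norm (chart_map a g - chart_map a \<one> - D (0, chart_map a g - chart_map a \<one>)) \<le> 1/4 * N g"
        using 1 2 by simp_all
    qed
    finally show ?thesis by simp
  qed
  \<comment> \<open>One constant \<open>L\<close> serves all \<open>h\<close> near \<one>.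
    Successive powers of \<open>g\<close> thus add their displacements of \<open>x\<close>, and no
    powers of \<open>L\<close> build up.\<close>
  have act_est: "norm (chart_map b (\<phi> h y) - chart_map b (\<phi> h y')) \<le> L * norm (chart_map b y - chart_map b y')"
    if "h \<in> U" "y \<in> V4" "y' \<in> V4" for h y y'
    using lip[of "(h, y)" "(h, y')"] UV4(5) that by (auto simp: U_def norm_Pair)
  obtain r where r: "r > 0" "\<And>e. e \<in> chart_model a \<Longrightarrow> norm (e - chart_map a \<one>) \<le> r
       \<Longrightarrow> \<exists>x \<in> U \<inter> chart_dom a. chart_map a x = e"
    using chart_nbhd[OF cha U a(2)] by blast
  have NU: "k \<in> U" if "k \<in> chart_dom a" "N k \<le> r" for k
    using r(2)[OF chart_map_model[OF cha that(1)]] that inj_onD[OF chart_inj[OF cha]] by (auto simp: N_def)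
  \<comment> \<open>The coordinate annulus between r/4 and r: a power that has drifted linearly by
    at least r/2, with relative error at most 1/2, has reached the radius r/4.\<close>
  define C where "C = (chart_model a \<inter> cball (chart_map a \<one>) r) - ball (chart_map a \<one>) (r/4)"
  define R where "R = {k \<in> chart_dom a. chart_map a k \<in> C}"
  have RN: "k \<in> R \<longleftrightarrow> k \<in> chart_dom a \<and> r/4 \<le> N k \<and> N k \<le> r" for k
    using chart_map_model[OF cha] by (auto simp: R_def C_def N_def dist_norm norm_minus_commute)
  have "compact C" unfolding C_def
    by (intro compact_diff closed_Int_compact closed_subspace is_chartD(1)[OF cha]) auto
  moreover have "C \<subseteq> chart_map a ` chart_dom a"
  proof
    fix e assume "e \<in> C"
    then have "e \<in> chart_model a" "norm (e - chart_map a \<one>) \<le> r" by (auto simp: C_def dist_norm norm_minus_commute)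
    from r(2)[OF this] show "e \<in> chart_map a ` chart_dom a" by blast
  qed
  ultimately have R: "compactin T R" unfolding R_def by (rule chart_compact_preimage[OF cha])
  have RU: "R \<subseteq> U" using RN NU by auto
  have "continuous_map (subtopology T U) (subtopology X (chart_dom b)) (\<lambda>k. \<phi> k x)"
    using act_continuous_left[OF xX]
    by (auto simp: continuous_map_in_subtopology U_def U5_def intro: continuous_map_from_subtopology)
  from continuous_map_compose[OF this chart_continuous[OF chb]]
  have "continuous_map (subtopology T U) euclideanreal q"
    unfolding q_def comp_def by (intro continuous_map_norm continuous_map_diff) auto
  moreover have "compactin (subtopology T U) R" using R RU by (simp add: compactin_subtopology)
  ultimately have cq: "compact (q ` R)"
    using image_compactin by (metis compactin_euclidean_iff)
  \<comment> \<open>Discreteness of the stabilizer enters here: \<open>U\<close> meets it only in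
    \<one>, which the annulus avoids.\<close>
  have qpos: "q k > 0" if "k \<in> R" for k
  proof -
    have "k \<in> U" "k \<noteq> \<one>" using that RU RN[of k] r(1) by (auto simp: N_def)
    then have "\<phi> k x \<noteq> x" "\<phi> k x \<in> chart_dom b"
      using U1(2) UG by (auto simp: U_def U5_def stabilizer_def)
    then show ?thesis using inj_onD[OF chart_inj[OF chb] _ _ x] by (auto simp: q_def)
  qed
  \<comment> \<open>The annulus is empty if the group has dimension 0.\<close>
  obtain q0 where q0: "q0 > 0" "\<And>k. k \<in> R \<Longrightarrow> q0 \<le> q k"
  proof (cases "R = {}")
    case True then show ?thesis using that[of 1] by simp
  next
    case False
    then obtain k where "k \<in> R" "\<And>k'. k' \<in> R \<Longrightarrow> q k \<le> q k'"
      using compact_attains_inf[OF cq] by auto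
    then show ?thesis using that qpos by blast
  qed
  \<comment> \<open>Chosen so that \<open>j\<close> steps with j * N g \<le> r move \<open>x\<close>
    by at most L * c * r = q0 / 2 if the estimate fails.\<close>
  define c where "c = q0 / (2 * r * L)"
  have c: "c > 0" using q0 r L by (simp add: c_def)
  have main: "c * N g \<le> q g" if g: "g \<in> chart_dom a" "N g < r / 8" for g
  proof (rule ccontr)
    assume "\<not> c * N g \<le> q g"
    then have lt: "q g < c * N g" by simp
    have "0 \<le> q g" by (simp add: q_def)
    then have "c * N g > 0" using lt by linarith
    then have Ng: "N g > 0" using c by (simp add: zero_less_mult_iff)
    have gU: "g \<in> U" using NU g r(1) by simp
    then have gG: "g \<in> carrier G" using UG by auto
    \<comment> \<open>The least number of steps with linear drift at least r/2. As N g < r/8, the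
      drift stays below 5r/8, and 3/2 of that is still below r, so no power up to \<open>j\<close>
      leaves the ball of radius r.\<close>
    define j where "j = nat \<lceil>r / (2 * N g)\<rceil>"
    have "r / (2 * N g) > 0" using r Ng by simp
    then have "real j = of_int \<lceil>r / (2 * N g)\<rceil>" by (simp add: j_def)
    then have "r / (2 * N g) \<le> real j" "real j < r / (2 * N g) + 1" by linarith+
    then have j: "r / 2 \<le> real j * N g" "real j * N g < r / 2 + N g"
      using Ng by (simp_all add: field_simps)
    have jN: "3 / 2 * (real i * N g) \<le> r" if "i \<le> j" for i
    proof -
      have "real i * N g \<le> real j * N g" using that Ng by simp
      then show ?thesis using j(2) g(2) r(1) by linarith
    qed
    have Nb: "real i * N g / 2 \<le> N (g [^] i) \<and> N (g [^] i) \<le> 3 / 2 * (real i * N g)"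
      if "norm (chart_map a (g [^] i) - chart_map a \<one> - real i *\<^sub>R (chart_map a g - chart_map a \<one>)) \<le> real i * N g / 2" for i :: nat
    proof -
      have "norm (real i *\<^sub>R (chart_map a g - chart_map a \<one>)) = real i * N g" by (simp add: N_def)
      then show ?thesis
        using that norm_triangle_ineq2[of "chart_map a (g [^] i) - chart_map a \<one>" "real i *\<^sub>R (chart_map a g - chart_map a \<one>)"]
          norm_triangle_ineq3[of "chart_map a (g [^] i) - chart_map a \<one>" "real i *\<^sub>R (chart_map a g - chart_map a \<one>)"]
        unfolding N_def by linarith
    qed
    \<comment> \<open>The drift estimate keeps the current power in \<open>U\<close>, where
      \<open>mult_est\<close> and \<open>act_est\<close> allow the next step; hence the three bounds
      are proved together.\<close>
    have pow: "g [^] i \<in> chart_dom a \<and>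
        norm (chart_map a (g [^] i) - chart_map a \<one> - real i *\<^sub>R (chart_map a g - chart_map a \<one>)) \<le> real i * N g / 2
        \<and> q (g [^] i) \<le> real i * (L * q g)" if "i \<le> j" for i :: nat
      using that
    proof (induction i)
      case 0
      then show ?case using a(2) act_one[OF xX] by (simp add: q_def)
    next
      case (Suc i)
      let ?h = "g [^] i"
      have IH: "?h \<in> chart_dom a"
        "norm (chart_map a ?h - chart_map a \<one> - real i *\<^sub>R (chart_map a g - chart_map a \<one>)) \<le> real i * N g / 2"
        "q ?h \<le> real i * (L * q g)"
        using Suc by auto
      have "N ?h \<le> r" using Nb[OF IH(2)] jN[of i] Suc.prems by linarith
      then have hU: "?h \<in> U" using NU IH(1) by blast
      then have hG: "?h \<in> carrier G" using UG by auto
      have gS: "g [^] Suc i = ?h \<otimes> g" by simp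
      have "chart_map a (?h \<otimes> g) - chart_map a \<one> - real (Suc i) *\<^sub>R (chart_map a g - chart_map a \<one>)
        = (chart_map a (?h \<otimes> g) - chart_map a ?h - (chart_map a g - chart_map a \<one>))
          + (chart_map a ?h - chart_map a \<one> - real i *\<^sub>R (chart_map a g - chart_map a \<one>))"
        by (simp add: algebra_simps)
      also have "norm \<dots> \<le> N g / 2 + real i * N g / 2"
        using mult_est[OF hU gU] IH(2) by (rule norm_triangle_mono)
      finally have 1: "norm (chart_map a (?h \<otimes> g) - chart_map a \<one> - real (Suc i) *\<^sub>R (chart_map a g - chart_map a \<one>))
        \<le> real (Suc i) * N g / 2" by (simp add: field_simps)
      have "\<phi> g x \<in> V4" using gU by (simp add: U_def U5_def)
      then have "norm (chart_map b (\<phi> ?h (\<phi> g x)) - chart_map b (\<phi> ?h x)) \<le> L * q g"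
        using act_est[OF hU _ UV4(4)] by (simp add: q_def)
      moreover have "chart_map b (\<phi> ?h (\<phi> g x)) - chart_map b x
         = (chart_map b (\<phi> ?h (\<phi> g x)) - chart_map b (\<phi> ?h x)) + (chart_map b (\<phi> ?h x) - chart_map b x)"
        by simp
      ultimately have "norm (chart_map b (\<phi> ?h (\<phi> g x)) - chart_map b x) \<le> L * q g + real i * (L * q g)"
        using IH(3) unfolding q_def by (metis norm_triangle_mono)
      then have 2: "q (?h \<otimes> g) \<le> real (Suc i) * (L * q g)"
        using act_mult[OF xX hG gG] by (simp add: q_def algebra_simps)
      show ?case unfolding gS using mult_dom[OF hU gU] 1 2 by blast
    qed
    have pj: "g [^] j \<in> chart_dom a"
        "norm (chart_map a (g [^] j) - chart_map a \<one> - real j *\<^sub>R (chart_map a g - chart_map a \<one>)) \<le> real j * N g / 2"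
        "q (g [^] j) \<le> real j * (L * q g)"
      using pow[of j] by auto
    have "g [^] j \<in> R"
      unfolding RN using pj(1) Nb[OF pj(2)] jN[of j] j(1) by simp
    then have "q0 \<le> real j * (L * q g)" using q0(2) pj(3) by (meson order_trans)
    also have "\<dots> \<le> real j * (L * (c * N g))"
      using lt L by (intro mult_left_mono) auto
    also have "\<dots> = (L * c) * (real j * N g)" by simp
    also have "\<dots> \<le> (L * c) * r"
      using jN[of j] L c r(1) j(1) by (intro mult_left_mono) auto
    also have "\<dots> = q0 / 2" using L r(1) by (simp add: c_def)
    finally show False using q0(1) by simp
  qed
  let ?U = "{k \<in> chart_dom a. chart_map a k \<in> ball (chart_map a \<one>) (r / 8)}"
  have "openin T ?U" by (rule chart_open_vimage[OF cha]) simp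
  moreover have "\<one> \<in> ?U" using a(2) r(1) by simp
  moreover have "c * norm (chart_map a g - chart_map a \<one>) \<le> norm (chart_map b (\<phi> g x) - chart_map b x)"
    if "g \<in> ?U" for g
    using main[of g] that by (simp add: N_def q_def dist_norm norm_minus_commute)
  ultimately show ?thesis using that c by blast
qed

text \<open>Translation to \<one>: write g = g0 k. As inv g0 fixes \<open>x\<close>, it carries the
  displacement \<phi> g x - x to \<phi> k x - x up to the Lipschitz factor \<open>L\<close>, while
  left multiplication by g0 costs \<open>M\<close> in the group.\<close>

lemma orbit_map_lower_bound:
  assumes lf: "locally_free G T X \<phi>"
    and a: "a \<in> A" "g0 \<in> chart_dom a" and b: "b \<in> B" and x: "x \<in> chart_dom b" and fixed: "\<phi> g0 x = x"
  obtains c U where "c > 0" "openin T U" "g0 \<in> U"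
    "\<And>g. g \<in> U \<Longrightarrow> c * norm (chart_map a g - chart_map a g0) \<le> norm (chart_map b (\<phi> g x) - chart_map b x)"
proof -
  note cha = T_chart[OF a(1)] and chb = X_chart[OF b]
  have xX: "x \<in> topspace X" using x is_chartD(5)[OF chb] by auto
  have g0: "g0 \<in> carrier G" using a(2) is_chartD(5)[OF cha] topspace_eq by auto
  have invx: "\<phi> (inv g0) x = x" using act_mult[OF xX inv_closed[OF g0] g0] fixed act_one[OF xX] g0 by simp
  obtain a1 where a1: "a1 \<in> A" "\<one> \<in> chart_dom a1" using T_cover by blast
  obtain a2 where a2: "a2 \<in> A" "inv g0 \<in> chart_dom a2" using T_cover g0 by blast
  obtain c1 U1 where c1: "c1 > 0" and U1: "openin T U1" "\<one> \<in> U1"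
    and lb: "\<And>g. g \<in> U1 \<Longrightarrow> c1 * norm (chart_map a1 g - chart_map a1 \<one>) \<le> norm (chart_map b (\<phi> g x) - chart_map b x)"
    using orbit_map_lower_bound_one[OF lf a1 b x] by metis
  have "g0 \<otimes> \<one> \<in> chart_dom a" using a g0 by simp
  then obtain D where "strict_deriv (prod_topology T T) (\<lambda>(g, h). (chart_map a g, chart_map a1 h))
      (\<lambda>(g, h). chart_map a (g \<otimes> h)) (g0, \<one>) D"
    using mult_strict_deriv[OF a(1) a1(1) a(1) a(2) a1(2)] by metis
  from strict_deriv_pair_snd[OF this]
  have "strict_deriv T (chart_map a1) (\<lambda>h. chart_map a (g0 \<otimes> h)) \<one> (\<lambda>v. D (0, v))"
    using g0 topspace_eq by simp
  then obtain M U2 where M: "M > 0" and U2: "openin T U2" "\<one> \<in> U2"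
    and lipM: "\<And>k k'. k \<in> U2 \<Longrightarrow> k' \<in> U2 \<Longrightarrow>
       norm (chart_map a (g0 \<otimes> k) - chart_map a (g0 \<otimes> k')) \<le> M * norm (chart_map a1 k - chart_map a1 k')"
    using strict_deriv_lipschitz by metis
  have "\<phi> (inv g0) x \<in> chart_dom b" using invx x by simp
  then obtain D' where "strict_deriv (prod_topology T X) (\<lambda>(g, x). (chart_map a2 g, chart_map b x))
      (\<lambda>(g, x). chart_map b (\<phi> g x)) (inv g0, x) D'"
    using act_strict_deriv[OF a2(1) b b a2(2) x] by metis
  from strict_deriv_pair_snd[OF this]
  have "strict_deriv X (chart_map b) (\<lambda>y. chart_map b (\<phi> (inv g0) y)) x (\<lambda>v. D' (0, v))"
    using g0 topspace_eq by simp
  then obtain L V where L: "L > 0" and V: "openin X V" "x \<in> V"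
    and lipL: "\<And>y y'. y \<in> V \<Longrightarrow> y' \<in> V \<Longrightarrow>
       norm (chart_map b (\<phi> (inv g0) y) - chart_map b (\<phi> (inv g0) y')) \<le> L * norm (chart_map b y - chart_map b y')"
    using strict_deriv_lipschitz by metis
  define U where "U = {g \<in> topspace T. inv g0 \<otimes> g \<in> U1 \<inter> U2} \<inter> {g \<in> topspace T. \<phi> g x \<in> V}"
  have "openin T U" unfolding U_def
    using openin_continuous_map_preimage[OF mult_continuous_right[OF inv_closed[OF g0]] openin_Int[OF U1(1) U2(1)]]
      openin_continuous_map_preimage[OF act_continuous_left[OF xX] V(1)] by (rule openin_Int)
  moreover have "g0 \<in> U" using U1(2) U2(2) V(2) g0 fixed topspace_eq by (simp add: U_def)
  ultimately have U: "openin T U" "g0 \<in> U" by auto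
  have "c1 / (M * L) * norm (chart_map a g - chart_map a g0) \<le> norm (chart_map b (\<phi> g x) - chart_map b x)"
    if "g \<in> U" for g
  proof -
    define k where "k = inv g0 \<otimes> g"
    have gG: "g \<in> carrier G" and k: "k \<in> U1" "k \<in> U2" and gx: "\<phi> g x \<in> V"
      using that by (auto simp: U_def k_def topspace_eq)
    have "g0 \<otimes> k = g" using g0 gG by (simp add: k_def m_assoc[symmetric])
    then have 1: "norm (chart_map a g - chart_map a g0) \<le> M * norm (chart_map a1 k - chart_map a1 \<one>)"
      using lipM[OF k(2) U2(2)] g0 by simp
    have "\<phi> k x = \<phi> (inv g0) (\<phi> g x)" using act_mult[OF xX] g0 gG by (simp add: k_def)
    then have 2: "norm (chart_map b (\<phi> k x) - chart_map b x) \<le> L * norm (chart_map b (\<phi> g x) - chart_map b x)"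
      using lipL[OF gx V(2)] invx by simp
    have "c1 * norm (chart_map a g - chart_map a g0) \<le> c1 * (M * norm (chart_map a1 k - chart_map a1 \<one>))"
      using 1 c1 by simp
    also have "\<dots> = M * (c1 * norm (chart_map a1 k - chart_map a1 \<one>))" by simp
    also have "\<dots> \<le> M * (L * norm (chart_map b (\<phi> g x) - chart_map b x))"
      using order_trans[OF lb[OF k(1)] 2] M by simp
    finally show ?thesis using M L by (simp add: field_simps)
  qed
  moreover have "c1 / (M * L) > 0" using c1 M L by simp
  ultimately show ?thesis using that U by blast
qed

section \<open>Fixing a point to first order\<close>

text \<open>A curve-free form of membership in the tangent stabilizer that is suited to limits. The
  derivative can be the identity of the whole type because only model vectors matter. Only the
  implication from \<open>tangent_stabilizer\<close> is proved; it suffices, as smallness passes to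
  subsets.\<close>

definition first_order_fixes :: "'g \<Rightarrow> 'm \<Rightarrow> bool" where
  "first_order_fixes g x \<longleftrightarrow> g \<in> carrier G \<and> x \<in> topspace X \<and> \<phi> g x = x \<and>
     (\<forall>b\<in>B. x \<in> chart_dom b \<longrightarrow>
        strict_deriv X (chart_map b) (\<lambda>y. chart_map b (\<phi> g y)) x (\<lambda>v. v))"

lemma first_order_fixesD:
  assumes "first_order_fixes g x"
  shows "g \<in> carrier G" "x \<in> topspace X" "\<phi> g x = x"
    "\<And>b. b \<in> B \<Longrightarrow> x \<in> chart_dom b \<Longrightarrow>
        strict_deriv X (chart_map b) (\<lambda>y. chart_map b (\<phi> g y)) x (\<lambda>v. v)"
  using assms by (auto simp: first_order_fixes_def)

lemma tangent_stabilizer_first_order_fixes: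
  assumes g: "g \<in> tangent_stabilizer G X B \<phi> x" and x: "x \<in> topspace X"
  shows "first_order_fixes g x"
proof -
  have gG: "g \<in> carrier G" and stab: "\<forall>v\<in>tangent_space X B x. differential X B (\<phi> g) x v = v"
    using g by (auto simp: tangent_stabilizer_def)
  obtain a where a: "a \<in> A" "g \<in> chart_dom a" using T_cover[OF gG] by blast
  have fx: "\<phi> g x = x"
    using X_cover[OF x] smooth_manifold.differential_fixed_point[OF smooth_manifold_axioms _ _ stab] by blast
  have "strict_deriv X (chart_map b) (\<lambda>y. chart_map b (\<phi> g y)) x (\<lambda>v. v)"
    if b: "b \<in> B" "x \<in> chart_dom b" for b
  proof -
    have "\<phi> g x \<in> chart_dom b" using fx b by simp
    then obtain D where "strict_deriv (prod_topology T X) (\<lambda>(g, x). (chart_map a g, chart_map b x))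
      (\<lambda>(g, x). chart_map b (\<phi> g x)) (g, x) D"
      using act_strict_deriv[OF a(1) b(1) b(1) a(2) b(2)] by metis
    from strict_deriv_pair_snd[OF this]
    have D: "strict_deriv X (chart_map b) (\<lambda>y. chart_map b (\<phi> g y)) x (\<lambda>v. D (0, v))"
      using gG topspace_eq by simp
    then have D': "strict_deriv X (chart_map b) (chart_map b \<circ> \<phi> g) x (\<lambda>v. D (0, v))"
      by (simp add: comp_def)
    show ?thesis
      by (rule strict_deriv_cong[OF X_chart[OF b(1)] b(2) D])
        (use smooth_manifold.differential_strict_deriv_id[OF smooth_manifold_axioms b stab D'] in auto)
  qed
  then show ?thesis using gG x fx by (simp add: first_order_fixes_def)
qed

lemma one_in_tangent_stabilizer:
  assumes "x \<in> topspace X"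
  shows "\<one> \<in> tangent_stabilizer G X B \<phi> x"
  using smooth_manifold.differential_id[OF smooth_manifold_axioms act_one assms]
  by (simp add: tangent_stabilizer_def)

text \<open>
  In charts, the derivative of \<open>\<phi> g x - x\<close> at \<open>(g0, x0)\<close> vanishes in the direction of \<open>x\<close> and is
  injective in the direction of \<open>g\<close>.
\<close>

lemma first_order_fixes_separation:
  assumes lf: "locally_free G T X \<phi>" and fo: "first_order_fixes g0 x0"
    and a: "a \<in> A" "g0 \<in> chart_dom a" and b: "b \<in> B" "x0 \<in> chart_dom b" and e: "e > 0"
  obtains U V where "openin T U" "openin X V" "g0 \<in> U" "x0 \<in> V"
    "\<And>g h x y. \<lbrakk>g \<in> U; h \<in> U; x \<in> V; y \<in> V; \<phi> g x = x; \<phi> h y = y\<rbrakk> \<Longrightarrow>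
       norm (chart_map a g - chart_map a h) \<le> e * norm (chart_map b x - chart_map b y)"
proof -
  note cha = T_chart[OF a(1)] and chb = X_chart[OF b(1)]
  note fx = first_order_fixesD(3)[OF fo]
  have "\<phi> g0 x0 \<in> chart_dom b" using fx b by simp
  then obtain D where D: "strict_deriv (prod_topology T X) (\<lambda>(g, x). (chart_map a g, chart_map b x))
      (\<lambda>(g, x). chart_map b (\<phi> g x)) (g0, x0) D"
    using act_strict_deriv[OF a(1) b(1) b(1) a(2) b(2)] by metis
  have D1: "strict_deriv T (chart_map a) (\<lambda>g. chart_map b (\<phi> g x0)) g0 (\<lambda>u. D (u, 0))"
    using strict_deriv_pair_fst[OF D] first_order_fixesD(2)[OF fo] by simp
  have D2: "strict_deriv X (chart_map b) (\<lambda>y. chart_map b (\<phi> g0 y)) x0 (\<lambda>v. D (0, v))"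
    using strict_deriv_pair_snd[OF D] first_order_fixesD(1)[OF fo] topspace_eq by simp
  have id: "D (0, v) = v" if "v \<in> chart_model b" for v
    by (rule strict_deriv_unique[OF chb b(2) D2 first_order_fixesD(4)[OF fo b] that])
  obtain c U0 where c: "c > 0" and U0: "openin T U0" "g0 \<in> U0"
    and lb: "\<And>g. g \<in> U0 \<Longrightarrow> c * norm (chart_map a g - chart_map a g0) \<le> norm (chart_map b (\<phi> g x0) - chart_map b x0)"
    using orbit_map_lower_bound[OF lf a b fx] by metis
  define k where "k = c / 2"
  have k: "k > 0" using c by (simp add: k_def)
  have low: "k * norm u \<le> norm (D (u, 0))" if "u \<in> chart_model a" for u
    unfolding k_def
    by (rule strict_deriv_lower_bound[OF cha a(2) D1 U0 c _ that]) (use lb fx in simp)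
  \<comment> \<open>The bound k/2 lets the term in \<open>g\<close> be absorbed on the left; k e / 2
    then leaves exactly the factor \<open>e\<close>.\<close>
  define d where "d = min (k / 2) (k * e / 2)"
  have d: "d > 0" "d \<le> k / 2" "d \<le> k * e / 2" using k e by (auto simp: d_def)
  obtain W where W: "openin (prod_topology T X) W" "(g0, x0) \<in> W"
    "lin_approx W (\<lambda>(g, x). (chart_map a g, chart_map b x)) (\<lambda>(g, x). chart_map b (\<phi> g x)) D d"
    using strict_derivE[OF D d(1)] by metis
  obtain U V where UV: "openin T U" "openin X V" "g0 \<in> U" "x0 \<in> V" "U \<times> V \<subseteq> W"
    using openin_prod_topologyE[OF W(1,2)] .
  show ?thesis
  proof (rule that[of "U \<inter> chart_dom a" "V \<inter> chart_dom b"])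
    show "openin T (U \<inter> chart_dom a)" "openin X (V \<inter> chart_dom b)"
      using UV is_chartD(2)[OF cha] is_chartD(2)[OF chb] by auto
    show "g0 \<in> U \<inter> chart_dom a" "x0 \<in> V \<inter> chart_dom b" using UV a b by auto
    fix g h x y
    assume gh: "g \<in> U \<inter> chart_dom a" "h \<in> U \<inter> chart_dom a" and xy: "x \<in> V \<inter> chart_dom b" "y \<in> V \<inter> chart_dom b"
      and fixed: "\<phi> g x = x" "\<phi> h y = y"
    let ?u = "chart_map a g - chart_map a h" and ?v = "chart_map b x - chart_map b y"
    have u: "?u \<in> chart_model a" and v: "?v \<in> chart_model b"
      using chart_diff_model[OF cha] chart_diff_model[OF chb] gh xy by auto
    have "(g, x) \<in> W" "(h, y) \<in> W" using gh xy UV(5) by auto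
    \<comment> \<open>Both points are fixed, so the increment of the action is \<open>?v\<close>
      itself; it cancels against D (0, ?v) below.\<close>
    then have "norm (?v - D (?u, ?v)) \<le> d * norm (?u, ?v)"
      using lin_approxD[OF W(3), of "(g, x)" "(h, y)"] fixed by simp
    moreover have "D (?u, ?v) = D (?u, 0) + D (0, ?v)"
      using linear_add[OF bounded_linear.linear[OF strict_deriv_linear[OF D]], of "(?u, 0)" "(0, ?v)"] by simp
    ultimately have "norm (D (?u, 0)) \<le> d * norm (?u, ?v)" using id[OF v] by simp
    also have "\<dots> \<le> d * (norm ?u + norm ?v)"
      using norm_Pair_le[of ?u ?v] d(1) by (intro mult_left_mono) auto
    finally have "k * norm ?u \<le> d * norm ?u + d * norm ?v"
      using low[OF u] by (simp add: distrib_left)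
    also have "\<dots> \<le> k / 2 * norm ?u + k * e / 2 * norm ?v"
      using d by (intro add_mono mult_right_mono) auto
    finally have "k * norm ?u \<le> k * (e * norm ?v)" by simp
    then show "norm ?u \<le> e * norm ?v" using k by simp
  qed
qed

text \<open>Fixed points survive limits since the manifold is Hausdorff. For derivatives, strictness
  at the limit pair makes D (0, _) an e-approximation of the derivative at every nearby pair; at a
  nearby pair from the set this derivative is the identity, so D (0, _) is within 2e of the identity
  on model vectors.\<close>

lemma closedin_first_order_fixes:
  "closedin (prod_topology T X) {(g, x). first_order_fixes g x}" (is "closedin ?P ?F")
proof -
  have sub: "?F \<subseteq> topspace ?P" using first_order_fixesD(1,2) topspace_eq by auto
  have "first_order_fixes g x" if cl: "(g, x) \<in> ?P closure_of ?F" for g x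
  proof -
    have gG: "g \<in> carrier G" and x: "x \<in> topspace X"
      using cl closure_of_subset_topspace[of ?P ?F] topspace_eq by auto
    have "(\<lambda>(g, x). \<phi> g x) (g, x) = snd (g, x)"
      by (rule forall_in_closure_of_eq[OF cl smooth_manifold.Hausdorff[OF smooth_manifold_axioms]
            act_continuous continuous_map_snd])
        (auto simp: first_order_fixes_def)
    then have fx: "\<phi> g x = x" by simp
    obtain a where a: "a \<in> A" "g \<in> chart_dom a" using T_cover[OF gG] by blast
    have "strict_deriv X (chart_map b) (\<lambda>y. chart_map b (\<phi> g y)) x (\<lambda>v. v)"
      if b: "b \<in> B" "x \<in> chart_dom b" for b
    proof -
      note chb = X_chart[OF b(1)]
      have "\<phi> g x \<in> chart_dom b" using fx b by simp
      then obtain D where D: "strict_deriv (prod_topology T X) (\<lambda>(g, x). (chart_map a g, chart_map b x))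
        (\<lambda>(g, x). chart_map b (\<phi> g x)) (g, x) D"
        using act_strict_deriv[OF a(1) b(1) b(1) a(2) b(2)] by metis
      have D2: "strict_deriv X (chart_map b) (\<lambda>y. chart_map b (\<phi> g y)) x (\<lambda>v. D (0, v))"
        using strict_deriv_pair_snd[OF D] gG topspace_eq by simp
      have "norm (D (0, u) - u) \<le> (e + e) * norm u" if u: "u \<in> chart_model b" and e: "e > 0" for u e
      proof -
        obtain W where W: "openin ?P W" "(g, x) \<in> W"
          "lin_approx W (\<lambda>(g, x). (chart_map a g, chart_map b x)) (\<lambda>(g, x). chart_map b (\<phi> g x)) D e"
          using strict_derivE[OF D e] by metis
        obtain U V where UV: "openin T U" "openin X V" "g \<in> U" "x \<in> V" "U \<times> V \<subseteq> W"
          using openin_prod_topologyE[OF W(1,2)] .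
        have "openin ?P (U \<times> (V \<inter> chart_dom b))"
          using UV is_chartD(2)[OF chb] by (auto simp: openin_prod_Times_iff)
        moreover have "(g, x) \<in> U \<times> (V \<inter> chart_dom b)" using UV b by auto
        ultimately have "\<exists>p. p \<in> ?F \<and> p \<in> U \<times> (V \<inter> chart_dom b)"
          using cl unfolding in_closure_of by metis
        then obtain g' x' where g': "g' \<in> U" and x': "x' \<in> V" "x' \<in> chart_dom b"
          and fo: "first_order_fixes g' x'"
          by auto
        obtain V' where V': "openin X V'" "x' \<in> V'" "lin_approx V' (chart_map b) (\<lambda>y. chart_map b (\<phi> g' y)) (\<lambda>v. v) e"
          using strict_derivE[OF first_order_fixesD(4)[OF fo b(1) x'(2)] e] by metis
        \<comment> \<open>The neighbourhood of the limit pair is reused with the group entry frozen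
          at g'.\<close>
        have "lin_approx V (chart_map b) (\<lambda>y. chart_map b (\<phi> g' y)) (\<lambda>v. D (0, v)) e"
          unfolding lin_approx_def
        proof (intro ballI)
          fix y z assume "y \<in> V" "z \<in> V"
          then have "(g', y) \<in> W" "(g', z) \<in> W" using UV(5) g' by auto
          then show "norm (chart_map b (\<phi> g' y) - chart_map b (\<phi> g' z) - D (0, chart_map b y - chart_map b z))
            \<le> e * norm (chart_map b y - chart_map b z)"
            using lin_approxD[OF W(3), of "(g', y)" "(g', z)"] by (simp add: norm_Pair)
        qed
        from lin_approx_compare[OF chb x'(2) UV(2) x'(1) this V' strict_deriv_linear[OF D2] bounded_linear_ident u]
        show ?thesis .
      qed
      then have "D (0, u) = u" if "u \<in> chart_model b" for u
        using that by (intro eq_by_epsilon[of _ _ "norm u"])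
      then show ?thesis
        by (intro strict_deriv_cong[OF chb b(2) D2]) auto
    qed
    then show ?thesis using gG x fx by (simp add: first_order_fixes_def)
  qed
  then have "?P closure_of ?F \<subseteq> ?F" by auto
  then show ?thesis using sub by (simp add: closure_of_subset_eq[symmetric])
qed

section \<open>The exceptional set is meager\<close>

text \<open>On a coordinate ball in \<open>W\<close>, the fixing element is a function of the point
  with vanishing derivative, hence a constant; this constant differs from \<one> and fixes an open
  set, against fixpoint rarity.\<close>

lemma first_order_fixes_open_imp_one:
  assumes lf: "locally_free G T X \<phi>" and fr: "fixpoint_rare G X \<phi>"
    and a: "a \<in> A" "K \<subseteq> chart_dom a" and one: "\<one> \<notin> K" and b: "b \<in> B"
    and lip: "\<And>g h x y. \<lbrakk>g \<in> K; h \<in> K; x \<in> W; y \<in> W; \<phi> g x = x; \<phi> h y = y\<rbrakk> \<Longrightarrow>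
       norm (chart_map a g - chart_map a h) \<le> norm (chart_map b x - chart_map b y)"
    and W: "openin X W" "W \<subseteq> chart_dom b" and ex: "\<And>x. x \<in> W \<Longrightarrow> \<exists>g\<in>K. first_order_fixes g x"
  shows "W = {}"
proof (rule ccontr)
  assume "W \<noteq> {}"
  then obtain x1 where x1: "x1 \<in> W" by blast
  note cha = T_chart[OF a(1)] and chb = X_chart[OF b]
  \<comment> \<open>No regularity of the choice is needed: \<open>lip\<close> with x = y shows that
    the fixing element in \<open>K\<close> is unique.\<close>
  obtain \<gamma> where \<gamma>: "\<And>x. x \<in> W \<Longrightarrow> \<gamma> x \<in> K" "\<And>x. x \<in> W \<Longrightarrow> first_order_fixes (\<gamma> x) x"
    using bchoice[of W "\<lambda>x g. g \<in> K \<and> first_order_fixes g x"] ex by blast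
  have x1b: "x1 \<in> chart_dom b" using x1 W(2) by auto
  obtain r where r: "r > 0" "\<And>e. e \<in> chart_model b \<Longrightarrow> norm (e - chart_map b x1) \<le> r
       \<Longrightarrow> \<exists>x \<in> W \<inter> chart_dom b. chart_map b x = e"
    using chart_nbhd[OF chb W(1) x1 x1b] by blast
  define Z where "Z = cball (chart_map b x1) r \<inter> chart_model b"
  have inW: "chart_inv b z \<in> W" and bz: "chart_map b (chart_inv b z) = z" if "z \<in> Z" for z
  proof -
    have "z \<in> chart_model b" "norm (z - chart_map b x1) \<le> r"
      using that by (auto simp: Z_def dist_norm norm_minus_commute)
    then obtain x where x: "x \<in> W \<inter> chart_dom b" "chart_map b x = z"
      using r(2) by blast
    then have "chart_inv b z = x" using chart_inv_left[OF chb] by auto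
    then show "chart_inv b z \<in> W" "chart_map b (chart_inv b z) = z" using x by auto
  qed
  have "convex Z" unfolding Z_def
    by (intro convex_Int convex_cball subspace_imp_convex is_chartD(1)[OF chb])
  define f where "f z = chart_map a (\<gamma> (chart_inv b z))" for z
  have flip: "norm (f y - f z) \<le> norm (y - z)" if "y \<in> Z" "z \<in> Z" for y z
    using lip[OF \<gamma>(1)[OF inW] \<gamma>(1)[OF inW] inW inW first_order_fixesD(3)[OF \<gamma>(2)[OF inW]]
        first_order_fixesD(3)[OF \<gamma>(2)[OF inW]], of y z] that bz
    by (simp add: f_def)
  have der: "(f has_derivative (\<lambda>h. 0)) (at z within Z)" if z: "z \<in> Z" for z
    unfolding has_derivative_within_alt
  proof (intro conjI allI impI)
    show "bounded_linear (\<lambda>h. 0)" by simp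
    fix e :: real assume "e > 0"
    let ?x = "chart_inv b z" let ?g = "\<gamma> ?x"
    have x: "?x \<in> W" "?x \<in> chart_dom b" using inW[OF z] W(2) by auto
    have g: "?g \<in> chart_dom a" using \<gamma>(1)[OF x(1)] a(2) by auto
    obtain U V where UV: "openin T U" "openin X V" "?g \<in> U" "?x \<in> V"
      and est: "\<And>g h x y. \<lbrakk>g \<in> U; h \<in> U; x \<in> V; y \<in> V; \<phi> g x = x; \<phi> h y = y\<rbrakk> \<Longrightarrow>
       norm (chart_map a g - chart_map a h) \<le> e * norm (chart_map b x - chart_map b y)"
      using first_order_fixes_separation[OF lf \<gamma>(2)[OF x(1)] a(1) g b x(2) \<open>e > 0\<close>] by metis
    obtain r1 where r1: "r1 > 0" "\<And>w. w \<in> chart_model a \<Longrightarrow> norm (w - chart_map a ?g) \<le> r1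
       \<Longrightarrow> \<exists>k \<in> U \<inter> chart_dom a. chart_map a k = w"
      using chart_nbhd[OF cha UV(1,3) g] by blast
    obtain r2 where r2: "r2 > 0" "\<And>w. w \<in> chart_model b \<Longrightarrow> norm (w - chart_map b ?x) \<le> r2
       \<Longrightarrow> \<exists>k \<in> V \<inter> chart_dom b. chart_map b k = w"
      using chart_nbhd[OF chb UV(2,4) x(2)] by blast
    have "norm (f y - f z - 0) \<le> e * norm (y - z)" if y: "y \<in> Z" "norm (y - z) < min r1 r2" for y
    proof -
      let ?y = "chart_inv b y"
      have yd: "?y \<in> W" "?y \<in> chart_dom b" "\<gamma> ?y \<in> chart_dom a"
        using inW[OF y(1)] W(2) \<gamma>(1)[OF inW[OF y(1)]] a(2) by auto
      \<comment> \<open>The crude Lipschitz bound acts as continuity: it brings \<gamma> y into the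
        neighbourhood where the estimate with the given \<open>e\<close> holds.\<close>
      have "norm (chart_map a (\<gamma> ?y) - chart_map a ?g) \<le> r1"
        using flip[OF y(1) z] y(2) by (simp add: f_def)
      then obtain k where "k \<in> U \<inter> chart_dom a" "chart_map a k = chart_map a (\<gamma> ?y)"
        using r1(2)[OF chart_map_model[OF cha yd(3)]] by blast
      then have 1: "\<gamma> ?y \<in> U" using inj_onD[OF chart_inj[OF cha]] yd(3) by blast
      have "norm (chart_map b ?y - chart_map b ?x) \<le> r2" using y(2) bz[OF y(1)] bz[OF z] by simp
      then obtain k where "k \<in> V \<inter> chart_dom b" "chart_map b k = chart_map b ?y"
        using r2(2)[OF chart_map_model[OF chb yd(2)]] by blast
      then have 2: "?y \<in> V" using inj_onD[OF chart_inj[OF chb]] yd(2) by blast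
      show ?thesis
        using est[OF 1 UV(3) 2 UV(4)] first_order_fixesD(3)[OF \<gamma>(2)] yd(1) x(1) bz[OF y(1)] bz[OF z]
        by (simp add: f_def)
    qed
    then show "\<exists>d>0. \<forall>y\<in>Z. norm (y - z) < d \<longrightarrow> norm (f y - f z - 0) \<le> e * norm (y - z)"
      using r1(1) r2(1) by (intro exI[of _ "min r1 r2"]) auto
  qed
  have x1Z: "chart_map b x1 \<in> Z" using r(1) chart_map_model[OF chb x1b] by (simp add: Z_def)
  let ?g = "\<gamma> x1"
  have const: "\<gamma> (chart_inv b z) = ?g" if "z \<in> Z" for z
  proof -
    have "f z = f (chart_map b x1)"
      by (rule has_derivative_zero_unique[OF \<open>convex Z\<close> der that x1Z])
    then have "chart_map a (\<gamma> (chart_inv b z)) = chart_map a ?g"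
      using chart_inv_left[OF chb x1b] by (simp add: f_def)
    then show ?thesis
      using inj_onD[OF chart_inj[OF cha]] \<gamma>(1)[OF inW[OF that]] \<gamma>(1)[OF x1] a(2) by blast
  qed
  let ?O = "{x \<in> chart_dom b. chart_map b x \<in> ball (chart_map b x1) r}"
  have "?O \<subseteq> invariants (topspace X) \<phi> ?g"
  proof
    fix x assume x: "x \<in> ?O"
    then have z: "chart_map b x \<in> Z" using chart_map_model[OF chb] by (auto simp: Z_def)
    have "chart_inv b (chart_map b x) = x" using x chart_inv_left[OF chb] by simp
    then have "x \<in> W" "\<gamma> x = ?g" using inW[OF z] const[OF z] by simp_all
    then show "x \<in> invariants (topspace X) \<phi> ?g"
      using first_order_fixesD(2,3)[OF \<gamma>(2)] by (force simp: invariants_def)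
  qed
  moreover have "openin X ?O" by (rule chart_open_vimage[OF chb]) simp
  moreover have "x1 \<in> ?O" using x1b r(1) by simp
  ultimately have "X interior_of (invariants (topspace X) \<phi> ?g) \<noteq> {}"
    using interior_of_maximal[of ?O "invariants (topspace X) \<phi> ?g" X] by blast
  moreover have "?g \<in> carrier G - {\<one>}"
    using \<gamma>[OF x1] one first_order_fixesD(1) by auto
  ultimately show False using fr by (simp add: fixpoint_rare_def)
qed

text \<open>The open \<open>U\<close> is enclosed in a compact \<open>K\<close> that avoids \<one>.
  Points in the closure of the set are still fixed to first order by some element of
  \<open>K\<close>, so interior points of the closure that lie in \<open>V\<close> form an open set
  as excluded by the preceding lemma.\<close>

lemma first_order_fixes_nowhere_dense:
  assumes lf: "locally_free G T X \<phi>" and fr: "fixpoint_rare G X \<phi>"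
    and fo: "first_order_fixes g0 x0" and ne: "g0 \<noteq> \<one>"
  obtains U V where "openin T U" "openin X V" "g0 \<in> U" "x0 \<in> V"
    "nowhere_dense_in X {x \<in> V. \<exists>g\<in>U. first_order_fixes g x}"
proof -
  obtain a where a: "a \<in> A" "g0 \<in> chart_dom a" using T_cover first_order_fixesD(1)[OF fo] by blast
  obtain b where b: "b \<in> B" "x0 \<in> chart_dom b" using X_cover first_order_fixesD(2)[OF fo] by blast
  note cha = T_chart[OF a(1)] and chb = X_chart[OF b(1)]
  obtain U1 V1 where UV1: "openin T U1" "openin X V1" "g0 \<in> U1" "x0 \<in> V1"
    and lip: "\<And>g h x y. \<lbrakk>g \<in> U1; h \<in> U1; x \<in> V1; y \<in> V1; \<phi> g x = x; \<phi> h y = y\<rbrakk> \<Longrightarrow>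
       norm (chart_map a g - chart_map a h) \<le> 1 * norm (chart_map b x - chart_map b y)"
    using first_order_fixes_separation[OF lf fo a b zero_less_one] by metis
  obtain U2 where U2: "openin T U2" "g0 \<in> U2" "\<one> \<notin> U2"
    using T_Hausdorff ne first_order_fixesD(1)[OF fo] topspace_eq unfolding Hausdorff_space_def
    by (metis disjnt_iff one_closed)
  have "openin T (U1 \<inter> U2)" "g0 \<in> U1 \<inter> U2" using UV1 U2 by auto
  then obtain r where r: "r > 0" "\<And>e. e \<in> chart_model a \<Longrightarrow> norm (e - chart_map a g0) \<le> r
       \<Longrightarrow> \<exists>x \<in> (U1 \<inter> U2) \<inter> chart_dom a. chart_map a x = e"
    using chart_nbhd[OF cha _ _ a(2)] by blast
  define C where "C = cball (chart_map a g0) r \<inter> chart_model a"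
  define K where "K = {k \<in> chart_dom a. chart_map a k \<in> C}"
  have "compact C" unfolding C_def
    by (intro compact_Int_closed closed_subspace is_chartD(1)[OF cha]) auto
  moreover have CU: "\<exists>x \<in> (U1 \<inter> U2) \<inter> chart_dom a. chart_map a x = e" if "e \<in> C" for e
    using r(2)[of e] that by (auto simp: C_def dist_norm norm_minus_commute)
  ultimately have K: "compactin T K"
    unfolding K_def by (intro chart_compact_preimage[OF cha]) blast+
  have KU: "K \<subseteq> U1 \<inter> U2"
    using CU inj_onD[OF chart_inj[OF cha]] unfolding K_def by blast
  define U where "U = {k \<in> chart_dom a. chart_map a k \<in> ball (chart_map a g0) r}"
  define V where "V = V1 \<inter> chart_dom b"
  have U: "openin T U" "g0 \<in> U" unfolding U_def
    using chart_open_vimage[OF cha open_ball] a(2) r(1) by auto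
  have V: "openin X V" "x0 \<in> V" unfolding V_def using UV1 b is_chartD(2)[OF chb] by auto
  have UK: "U \<subseteq> K" using chart_map_model[OF cha] by (auto simp: U_def K_def C_def)
  define M where "M = {x. \<exists>g\<in>K. first_order_fixes g x}"
  let ?F = "{(g, x). first_order_fixes g x}"
  have "closedin (prod_topology (subtopology T K) X) (?F \<inter> K \<times> topspace X)"
    unfolding prod_topology_subtopology closedin_subtopology
    using closedin_first_order_fixes by blast
  moreover have "compact_space (subtopology T K)" using K by (simp add: compact_space_subtopology)
  \<comment> \<open>Projection along a compact factor is a closed map.\<close>
  ultimately have "closedin X (snd ` (?F \<inter> K \<times> topspace X))"
    using closed_map_snd unfolding closed_map_def by blast
  moreover have "snd ` (?F \<inter> K \<times> topspace X) = M"
    using first_order_fixesD(2) by (force simp: M_def)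
  ultimately have M: "closedin X M" by simp
  let ?S = "{x \<in> V. \<exists>g\<in>U. first_order_fixes g x}"
  have SM: "?S \<subseteq> M" using UK by (auto simp: M_def)
  have clM: "X closure_of ?S \<subseteq> M" using closure_of_minimal[OF SM M] .
  let ?O = "X interior_of (X closure_of ?S)"
  have "?O \<inter> V = {}"
  proof (rule first_order_fixes_open_imp_one[OF lf fr a(1) _ _ b(1)])
    show "K \<subseteq> chart_dom a" by (auto simp: K_def)
    show "\<one> \<notin> K" using KU U2(3) by blast
    show "openin X (?O \<inter> V)" using V(1) by (intro openin_Int openin_interior_of)
    show "?O \<inter> V \<subseteq> chart_dom b" by (auto simp: V_def)
    show "\<exists>g\<in>K. first_order_fixes g x" if "x \<in> ?O \<inter> V" for x
      using that interior_of_subset[of X "X closure_of ?S"] clM by (auto simp: M_def)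
    show "norm (chart_map a g - chart_map a h) \<le> norm (chart_map b x - chart_map b y)"
      if "g \<in> K" "h \<in> K" "x \<in> ?O \<inter> V" "y \<in> ?O \<inter> V" "\<phi> g x = x" "\<phi> h y = y" for g h x y
      using lip[of g h x y] that KU by (auto simp: V_def)
  qed
  \<comment> \<open>The bounds are available only inside \<open>V\<close>, but \<open>V\<close>
    contains \<open>?S\<close>: an open set disjoint from \<open>?S\<close> is disjoint from its
    closure, in which \<open>?O\<close> is contained.\<close>
  then have "?O \<inter> ?S = {}" by blast
  then have "?O \<inter> X closure_of ?S = {}"
    by (simp add: openin_Int_closure_of_eq_empty)
  then have "?O = {}" using interior_of_subset[of X "X closure_of ?S"] by blast
  moreover have "?S \<subseteq> topspace X" using first_order_fixesD(2) by auto
  ultimately have "nowhere_dense_in X ?S" by (simp add: nowhere_dense_in_def)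
  then show ?thesis using that U V by blast
qed

lemma nowhere_dense_in_subset:
  "nowhere_dense_in X S \<Longrightarrow> R \<subseteq> S \<Longrightarrow> nowhere_dense_in X R"
  unfolding nowhere_dense_in_def
  using interior_of_mono[OF closure_of_mono[of R S X]] by (metis order_trans subset_empty)

text \<open>A Lindelof argument: the neighbourhoods depend on the pair (g, x), but shrinking them to
  basic sets leaves only countably many pairs (U', V').\<close>

lemma meager_nontrivial_tangent_stabilizer:
  assumes lf: "locally_free G T X \<phi>" and fr: "fixpoint_rare G X \<phi>"
  shows "meager_in X {x \<in> topspace X. tangent_stabilizer G X B \<phi> x \<noteq> {\<one>}}"
    (is "meager_in X ?L")
proof -
  obtain \<T> where \<T>: "countable \<T>" "\<And>U g. openin T U \<Longrightarrow> g \<in> U \<Longrightarrow> \<exists>V\<in>\<T>. g \<in> V \<and> V \<subseteq> U"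
    using T_second_countable unfolding second_countable_def by metis
  obtain \<X> where \<X>: "countable \<X>" "\<And>U x. openin X U \<Longrightarrow> x \<in> U \<Longrightarrow> \<exists>V\<in>\<X>. x \<in> V \<and> V \<subseteq> U"
    using smooth_manifold.second_countable[OF smooth_manifold_axioms] unfolding second_countable_def by metis
  \<comment> \<open>\<open>meager_in\<close> demands equality with the union, so the pieces are cut
    out by the tangent stabilizer itself and by g \<noteq> \<one>; this keeps each inside
    \<open>?L\<close>. Basic pairs with large pieces are discarded in \<N>.\<close>
  define S where "S = (\<lambda>(U, V). {x \<in> V \<inter> topspace X. \<exists>g\<in>U. g \<noteq> \<one> \<and> g \<in> tangent_stabilizer G X B \<phi> x})"
  define \<N> where "\<N> = {N \<in> S ` (\<T> \<times> \<X>). nowhere_dense_in X N}"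
  have "countable \<N>" unfolding \<N>_def using \<T>(1) \<X>(1)
    by (intro countable_Collect countable_image countable_SIGMA)
  moreover have "?L = \<Union>\<N>"
  proof
    show "\<Union>\<N> \<subseteq> ?L" by (auto simp: \<N>_def S_def)
    show "?L \<subseteq> \<Union>\<N>"
    proof
      fix x assume "x \<in> ?L"
      then have x: "x \<in> topspace X" and "tangent_stabilizer G X B \<phi> x \<noteq> {\<one>}" by auto
      then obtain g where g: "g \<in> tangent_stabilizer G X B \<phi> x" "g \<noteq> \<one>"
        using one_in_tangent_stabilizer[OF x] by blast
      obtain U V where UV: "openin T U" "openin X V" "g \<in> U" "x \<in> V"
        "nowhere_dense_in X {x \<in> V. \<exists>g\<in>U. first_order_fixes g x}"
        using first_order_fixes_nowhere_dense[OF lf fr tangent_stabilizer_first_order_fixes[OF g(1) x] g(2)] .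
      obtain U' where U': "U' \<in> \<T>" "g \<in> U'" "U' \<subseteq> U" using \<T>(2)[OF UV(1,3)] by blast
      obtain V' where V': "V' \<in> \<X>" "x \<in> V'" "V' \<subseteq> V" using \<X>(2)[OF UV(2,4)] by blast
      have "S (U', V') \<subseteq> {x \<in> V. \<exists>g\<in>U. first_order_fixes g x}"
        using U'(3) V'(3) tangent_stabilizer_first_order_fixes by (fastforce simp: S_def)
      then have "nowhere_dense_in X (S (U', V'))" using nowhere_dense_in_subset UV(5) by blast
      then have "S (U', V') \<in> \<N>" using U'(1) V'(1) by (auto simp: \<N>_def)
      moreover have "x \<in> S (U', V')" using x g U'(2) V'(2) by (auto simp: S_def)
      ultimately show "x \<in> \<Union>\<N>" by blast
    qed
  qed
  ultimately show ?thesis unfolding meager_in_def by (auto simp: \<N>_def)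
qed

end

theorem theorem8p1:
  fixes G :: "('g, 'z) monoid_scheme"
    and T :: "'g topology" and A :: "('g, 'd::euclidean_space) chart set"
    and X :: "'m topology" and B :: "('m, 'e::euclidean_space) chart set"
    and \<phi> :: "'g \<Rightarrow> 'm \<Rightarrow> 'm"
  assumes "smooth_action G T A X B \<phi>"
    and "locally_free G T X \<phi>"
    and "fixpoint_rare G X \<phi>"
  shows "meager_in X {x \<in> topspace X. tangent_stabilizer G X B \<phi> x \<noteq> {one G}}"
  using smooth_action.meager_nontrivial_tangent_stabilizer[OF assms] .

end
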